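(* Let $n\in\mathbb{N}$, let $\Omega\subset\mathbb{R}^n$ be a smooth, bounded domain, let $D_u,D_v,\chi_u,\chi_v>0$, let $f,g$ be nonnegative, real analytic functions on $(-\varepsilon,\infty)$ for some $\varepsilon>0$, and suppose that $(u,v,w,z)\in(C^2(\overline\Omega))^4$ is a nonnegative classical solution of $$\begin{cases}0=D_u\Delta u+\chi_u\nabla\cdot(u\nabla w)&\text{in }\Omega,\\ 0=D_v\Delta v+\chi_v\nabla\cdot(v\nabla z)&\text{in }\Omega,\\ 0=-w+f(v)&\text{in }\Omega,\\ 0=-z+g(u)&\text{in }\Omega,\\ D_u\partial_\nu u+\chi_u u\partial_\nu w=D_v\partial_\nu v+\chi_v v\partial_\nu z=0&\text{on }\partial\Omega.\end{cases}$$ Then $u,v,w$ and $z$ are constant.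
   Context: $\partial_\nu$ denotes the outward normal derivative on $\partial\Omega$. A domain is a connected open set. A quadruple is nonnegative if all its components are nonnegative. *)

theory Defs
  imports "HOL-Analysis.Analysis"
begin

definition partial_deriv :: "'n::finite \<Rightarrow> (real ^ 'n \<Rightarrow> real) \<Rightarrow> real ^ 'n \<Rightarrow> real" where
  "partial_deriv i f x = frechet_derivative f (at x) (axis i 1)"

definition gradient :: "(real ^ 'n::finite \<Rightarrow> real) \<Rightarrow> real ^ 'n \<Rightarrow> real ^ 'n" where
  "gradient f x = (\<chi> i. partial_deriv i f x)"

definition divergence :: "(real ^ 'n::finite \<Rightarrow> real ^ 'n) \<Rightarrow> real ^ 'n \<Rightarrow> real" where
  "divergence F x = (\<Sum>i\<in>UNIV. partial_deriv i (\<lambda>y. F y $ i) x)"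

definition laplacian :: "(real ^ 'n::finite \<Rightarrow> real) \<Rightarrow> real ^ 'n \<Rightarrow> real" where
  "laplacian f x = (\<Sum>i\<in>UNIV. partial_deriv i (partial_deriv i f) x)"

text \<open>\<open>C_k_on k U f\<close> is meant for open \<open>U\<close>: \<open>f\<close> is \<open>k\<close> times continuously differentiable on \<open>U\<close>.\<close>

primrec C_k_on :: "nat \<Rightarrow> (real ^ 'n::finite) set \<Rightarrow> (real ^ 'n \<Rightarrow> real) \<Rightarrow> bool" where
  "C_k_on 0 U f \<longleftrightarrow> continuous_on U f"
| "C_k_on (Suc k) U f \<longleftrightarrow>
     (\<forall>x\<in>U. f differentiable (at x)) \<and> (\<forall>i. C_k_on k U (partial_deriv i f))"

definition smooth_on :: "(real ^ 'n::finite) set \<Rightarrow> (real ^ 'n \<Rightarrow> real) \<Rightarrow> bool" where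
  "smooth_on U f \<longleftrightarrow> (\<forall>k. C_k_on k U f)"

definition extends_continuously :: "(real ^ 'n::finite) set \<Rightarrow> (real ^ 'n \<Rightarrow> real) \<Rightarrow> bool" where
  "extends_continuously \<Omega> f \<longleftrightarrow>
     (\<exists>g. continuous_on (closure \<Omega>) g \<and> (\<forall>x\<in>\<Omega>. g x = f x))"

text \<open>The space \<open>C\<^sup>2\<close> on the closure of an open set \<open>\<Omega>\<close>: the function itself is
  continuous on the closure, and its partial derivatives of orders 1 and 2, taken in \<open>\<Omega>\<close>,
  extend continuously to the closure. Values outside the closure are irrelevant.\<close>

definition C2_closure :: "(real ^ 'n::finite) set \<Rightarrow> (real ^ 'n \<Rightarrow> real) \<Rightarrow> bool" where
  "C2_closure \<Omega> f \<longleftrightarrow>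
     continuous_on (closure \<Omega>) f \<and> C_k_on 2 \<Omega> f \<and>
     (\<forall>i. extends_continuously \<Omega> (partial_deriv i f)) \<and>
     (\<forall>i j. extends_continuously \<Omega> (partial_deriv j (partial_deriv i f)))"

definition local_defining_function ::
    "(real ^ 'n::finite) set \<Rightarrow> real ^ 'n \<Rightarrow> (real ^ 'n) set \<Rightarrow> (real ^ 'n \<Rightarrow> real) \<Rightarrow> bool" where
  "local_defining_function \<Omega> p U \<rho> \<longleftrightarrow>
     open U \<and> p \<in> U \<and> smooth_on U \<rho> \<and> (\<forall>x\<in>U. gradient \<rho> x \<noteq> 0) \<and>
     \<Omega> \<inter> U = {x \<in> U. \<rho> x < 0}"

text \<open>As the gradient of \<open>\<rho>\<close> has no zeros, \<open>frontier \<Omega>\<close> is the zero set of \<open>\<rho>\<close> in \<open>U\<close>,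
  and \<open>\<Omega>\<close> lies on one side of it.\<close>

definition smooth_bounded_domain :: "(real ^ 'n::finite) set \<Rightarrow> bool" where
  "smooth_bounded_domain \<Omega> \<longleftrightarrow>
     open \<Omega> \<and> connected \<Omega> \<and> bounded \<Omega> \<and>
     (\<forall>p\<in>frontier \<Omega>. \<exists>U \<rho>. local_defining_function \<Omega> p U \<rho>)"

definition outward_normal :: "(real ^ 'n::finite) set \<Rightarrow> real ^ 'n \<Rightarrow> real ^ 'n" where
  "outward_normal \<Omega> p =
     (THE \<nu>. \<exists>U \<rho>. local_defining_function \<Omega> p U \<rho> \<and> \<nu> = sgn (gradient \<rho> p))"

text \<open>The gradient at a boundary point is the limit of the gradients taken in \<open>\<Omega>\<close>, which
  exists for functions in \<open>C2_closure \<Omega>\<close>.\<close>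

definition normal_derivative ::
    "(real ^ 'n::finite) set \<Rightarrow> (real ^ 'n \<Rightarrow> real) \<Rightarrow> real ^ 'n \<Rightarrow> real" where
  "normal_derivative \<Omega> f p = outward_normal \<Omega> p \<bullet> Lim (at p within \<Omega>) (gradient f)"

definition real_analytic_on :: "(real \<Rightarrow> real) \<Rightarrow> real set \<Rightarrow> bool" where
  "real_analytic_on f S \<longleftrightarrow>
     (\<forall>a\<in>S. \<exists>r>0. \<exists>c. \<forall>x\<in>ball a r. (\<lambda>k. c k * (x - a) ^ k) sums f x)"

text \<open>The outward normal is independent of the local defining function.\<close>

lemma gradient_has_derivative:
  assumes "f differentiable (at x)"
  shows "(f has_derivative (\<lambda>h. gradient f x \<bullet> h)) (at x)"
proof -
  let ?D = "frechet_derivative f (at x)"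
  have D: "(f has_derivative ?D) (at x)"
    using assms by (simp add: frechet_derivative_works)
  then have lin: "linear ?D" by (rule has_derivative_linear)
  have "?D h = gradient f x \<bullet> h" for h
  proof -
    have "?D h = ?D (\<Sum>i\<in>UNIV. (h $ i) *\<^sub>R axis i 1)"
      by (simp add: basis_expansion flip: scalar_mult_eq_scaleR)
    also have "\<dots> = (\<Sum>i\<in>UNIV. h $ i * ?D (axis i 1))"
      by (simp add: linear_sum[OF lin] linear_scale[OF lin])
    also have "\<dots> = gradient f x \<bullet> h"
      by (simp add: gradient_def partial_deriv_def inner_vec_def mult.commute)
    finally show ?thesis .
  qed
  then have "?D = (\<lambda>h. gradient f x \<bullet> h)" by auto
  with D show ?thesis by simp
qed

lemma local_defining_function_differentiable:
  assumes "local_defining_function \<Omega> p U \<rho>"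
  shows "\<rho> differentiable (at p)"
proof -
  have "C_k_on (Suc 0) U \<rho>" "p \<in> U"
    using assms unfolding local_defining_function_def smooth_on_def by blast+
  then show ?thesis by simp
qed

lemma local_defining_function_zero:
  assumes "open \<Omega>" "p \<in> frontier \<Omega>" "local_defining_function \<Omega> p U \<rho>"
  shows "\<rho> p = 0"
proof (rule ccontr)
  assume nz: "\<rho> p \<noteq> 0"
  have U: "open U" "p \<in> U" "\<Omega> \<inter> U = {x \<in> U. \<rho> x < 0}"
    using assms(3) unfolding local_defining_function_def by auto
  have p: "p \<notin> \<Omega>" "p \<in> closure \<Omega>"
    using assms(1,2) by (auto simp: frontier_def interior_open)
  then have "\<rho> p > 0" using U nz by force
  moreover have "isCont \<rho> p"
    using local_defining_function_differentiable[OF assms(3)] differentiable_imp_continuous_within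
    by blast
  ultimately have "\<forall>\<^sub>F x in nhds p. \<rho> x > 0"
    by (metis order_tendstoD(1) continuous_within tendsto_at_iff_tendsto_nhds)
  then obtain V where V: "open V" "p \<in> V" "\<forall>x\<in>V. \<rho> x > 0"
    unfolding eventually_nhds by blast
  have "\<Omega> \<inter> (U \<inter> V) \<noteq> {}"
    using open_Int_closure_eq_empty[of "U \<inter> V" \<Omega>] p U V by blast
  then obtain x where "x \<in> \<Omega>" "x \<in> U" "x \<in> V" by blast
  then have "\<rho> x < 0" "\<rho> x > 0" using U(3) V(3) by auto
  then show False by simp
qed

lemma local_defining_function_ray:
  assumes "open \<Omega>" "p \<in> frontier \<Omega>" "local_defining_function \<Omega> p U \<rho>"
  shows "gradient \<rho> p \<bullet> d < 0 \<Longrightarrow> \<forall>\<^sub>F t in at_right 0. p + t *\<^sub>R d \<in> \<Omega>"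
    and "gradient \<rho> p \<bullet> d > 0 \<Longrightarrow> \<forall>\<^sub>F t in at_right 0. p + t *\<^sub>R d \<notin> \<Omega>"
proof -
  have U: "open U" "p \<in> U" "\<Omega> \<inter> U = {x \<in> U. \<rho> x < 0}"
    using assms(3) unfolding local_defining_function_def by auto
  let ?\<gamma> = "\<lambda>t::real. p + t *\<^sub>R d"
  have "(\<rho> has_derivative (\<lambda>h. gradient \<rho> p \<bullet> h)) (at (?\<gamma> 0))"
    using gradient_has_derivative[OF local_defining_function_differentiable[OF assms(3)]] by simp
  moreover have "(?\<gamma> has_derivative (\<lambda>t. t *\<^sub>R d)) (at 0)"
    by (auto intro!: derivative_eq_intros)
  ultimately have "((\<lambda>t. \<rho> (?\<gamma> t)) has_derivative (\<lambda>t. gradient \<rho> p \<bullet> (t *\<^sub>R d))) (at 0)"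
    by (rule has_derivative_compose[rotated])
  then have der: "((\<lambda>t. \<rho> (?\<gamma> t)) has_real_derivative (gradient \<rho> p \<bullet> d)) (at 0)"
    unfolding has_field_derivative_def
    by (rule has_derivative_eq_rhs) (auto simp: mult.commute)
  have "((\<lambda>t. (\<rho> (?\<gamma> t) - \<rho> p) / t) \<longlongrightarrow> gradient \<rho> p \<bullet> d) (at 0)"
    using der unfolding has_field_derivative_iff by simp
  then have "((\<lambda>t. \<rho> (?\<gamma> t) / t) \<longlongrightarrow> gradient \<rho> p \<bullet> d) (at 0)"
    by (simp add: local_defining_function_zero[OF assms])
  then have lim: "((\<lambda>t. \<rho> (?\<gamma> t) / t) \<longlongrightarrow> gradient \<rho> p \<bullet> d) (at_right 0)"
    by (rule filterlim_mono) (auto simp: at_le)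
  have "(?\<gamma> \<longlongrightarrow> p + 0 *\<^sub>R d) (at_right 0)"
    by (intro tendsto_intros)
  then have inU: "\<forall>\<^sub>F t in at_right 0. ?\<gamma> t \<in> U"
    using U(1,2) by (auto dest: topological_tendstoD)
  have pos: "\<forall>\<^sub>F t::real in at_right 0. t > 0"
    by (rule eventually_at_right_less)
  show "\<forall>\<^sub>F t in at_right 0. ?\<gamma> t \<in> \<Omega>" if "gradient \<rho> p \<bullet> d < 0"
    using order_tendstoD(2)[OF lim that] inU pos
  proof eventually_elim
    case (elim t)
    then have "\<rho> (?\<gamma> t) < 0" by (simp add: divide_less_0_iff)
    then show ?case using elim U(3) by blast
  qed
  show "\<forall>\<^sub>F t in at_right 0. ?\<gamma> t \<notin> \<Omega>" if "gradient \<rho> p \<bullet> d > 0"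
    using order_tendstoD(1)[OF lim that] inU pos
  proof eventually_elim
    case (elim t)
    then have "\<not> \<rho> (?\<gamma> t) < 0" by (simp add: zero_less_divide_iff)
    then show ?case using elim U(3) by blast
  qed
qed

lemma sgn_gradient_unique:
  assumes "open \<Omega>" "p \<in> frontier \<Omega>"
    and "local_defining_function \<Omega> p U \<rho>" "local_defining_function \<Omega> p V \<sigma>"
  shows "sgn (gradient \<rho> p) = sgn (gradient \<sigma> p)"
proof (rule ccontr)
  let ?a = "gradient \<rho> p" and ?b = "gradient \<sigma> p"
  assume ne: "sgn ?a \<noteq> sgn ?b"
  have nz: "?a \<noteq> 0" "?b \<noteq> 0"
    using assms(3,4) unfolding local_defining_function_def by auto
  have n1: "sgn ?a \<bullet> sgn ?a = 1" "sgn ?b \<bullet> sgn ?b = 1"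
    using nz by (simp_all add: norm_sgn flip: norm_eq_1)
  have lt: "sgn ?a \<bullet> sgn ?b < 1"
  proof -
    have "0 < (sgn ?a - sgn ?b) \<bullet> (sgn ?a - sgn ?b)" using ne by simp
    then show ?thesis by (simp add: inner_diff_left inner_diff_right n1 inner_commute)
  qed
  define d where "d = sgn ?b - sgn ?a"
  have "sgn ?a \<bullet> d < 0" "sgn ?b \<bullet> d > 0"
    using lt by (simp_all add: d_def inner_diff_right n1 inner_commute)
  moreover have "?a = norm ?a *\<^sub>R sgn ?a" "?b = norm ?b *\<^sub>R sgn ?b"
    using nz by (simp_all add: sgn_div_norm)
  ultimately have "?a \<bullet> d < 0" "?b \<bullet> d > 0"
    using nz by (metis inner_scaleR_left mult_pos_neg zero_less_norm_iff)
       (metis \<open>sgn ?b \<bullet> d > 0\<close> \<open>?b = norm ?b *\<^sub>R sgn ?b\<close> nz(2)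
         inner_scaleR_left mult_pos_pos zero_less_norm_iff)
  then have "\<forall>\<^sub>F t in at_right 0. p + t *\<^sub>R d \<in> \<Omega>" "\<forall>\<^sub>F t in at_right 0. p + t *\<^sub>R d \<notin> \<Omega>"
    using local_defining_function_ray assms by blast+
  then have "\<forall>\<^sub>F t::real in at_right 0. False" by eventually_elim simp
  then show False by simp
qed

lemma outward_normal_eq:
  assumes "open \<Omega>" "p \<in> frontier \<Omega>" "local_defining_function \<Omega> p U \<rho>"
  shows "outward_normal \<Omega> p = sgn (gradient \<rho> p)"
  unfolding outward_normal_def
  by (rule the_equality) (use assms sgn_gradient_unique in blast)+

end

theory Submission
  imports Defs "HOL-Complex_Analysis.Complex_Analysis"
begin

text \<open>
  With \<open>a = \<chi>\<^sub>u / D\<^sub>u\<close>, the flux \<open>D\<^sub>u \<nabla>u + \<chi>\<^sub>u u \<nabla>w\<close> equals \<open>D\<^sub>u exp (- a w) \<nabla>\<phi>\<close> for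
  \<open>\<phi> = u exp (a w)\<close>. Hence \<open>\<phi>\<close> solves the linear equation \<open>\<Delta>\<phi> - a \<nabla>w \<bullet> \<nabla>\<phi> = 0\<close>, which has bounded
  coefficients and no term of order zero, and its normal derivative vanishes on the boundary.
  Such a function is constant (\<open>neumann_subsolution_constant\<close>): its maximum cannot lie on the
  boundary only, by the lemma of Hopf, and a maximum inside forces constancy, by the strong
  maximum principle. Both facts come from the same barrier estimate on a ball that touches the
  set of maximum points (\<open>hopf_difference_quotient\<close>); at a boundary point, smoothness of the boundary
  provides this ball (\<open>interior_sphere\<close>).

  Consequently \<open>u = c\<^sub>u exp (- a f(v))\<close> and, likewise, \<open>v = c\<^sub>v exp (- b g(u))\<close> with
  \<open>b = \<chi>\<^sub>v / D\<^sub>v\<close>. So every value of \<open>u\<close> is a fixed point of one real analytic function \<open>P\<close> on \<open>(-\<epsilon>, \<infinity>)\<close>, and \<open>P \<le> c\<^sub>u\<close>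
  because \<open>f\<close> is nonnegative. If \<open>u\<close> took two values, it would, as \<open>\<Omega>\<close> is connected, take all
  values between them; by the identity theorem \<open>P s = s\<close> would then hold for all \<open>s > -\<epsilon>\<close>,
  which contradicts the bound for large \<open>s\<close>. Hence \<open>u\<close> is constant, and \<open>v\<close>, \<open>w\<close>, \<open>z\<close> are
  functions of \<open>u\<close>.
\<close>

(* The symbol $ then denotes vector components only, not coefficients of power series. *)
no_notation fps_nth (infixl \<open>$\<close> 75)

section \<open>Maxima and second derivatives\<close>

text \<open>
  A partial derivative as a relation instead of a function: the rules for derivatives of one real
  variable then prove statements about sums and products directly.
\<close>

definition has_partial :: "'n::finite \<Rightarrow> (real ^ 'n \<Rightarrow> real) \<Rightarrow> real \<Rightarrow> real ^ 'n \<Rightarrow> bool" where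
  "has_partial i f c x \<longleftrightarrow> ((\<lambda>t. f (x + t *\<^sub>R axis i 1)) has_real_derivative c) (at 0)"

text \<open>
  \<open>G\<close> is the gradient of \<open>\<phi>\<close> and the components of \<open>H\<close> are its unmixed second derivatives, so the
  Laplacian is the sum of the components of \<open>H\<close>. Carrying \<open>G\<close> and \<open>H\<close> as data allows closed
  formulas for them to be used in the maximum principle, which involves unmixed second derivatives
  only.
\<close>

definition second_order_on ::
    "(real ^ 'n::finite) set \<Rightarrow> (real ^ 'n \<Rightarrow> real) \<Rightarrow> (real ^ 'n \<Rightarrow> real ^ 'n) \<Rightarrow>
     (real ^ 'n \<Rightarrow> real ^ 'n) \<Rightarrow> bool" where
  "second_order_on S \<phi> G H \<longleftrightarrow>
     (\<forall>x\<in>S. (\<phi> has_derivative (\<lambda>h. G x \<bullet> h)) (at x) \<and>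
        (\<forall>i. has_partial i (\<lambda>y. G y $ i) (H x $ i) x))"

lemma second_order_on_subset:
  "second_order_on S \<phi> G H \<Longrightarrow> T \<subseteq> S \<Longrightarrow> second_order_on T \<phi> G H"
  unfolding second_order_on_def by blast

lemma second_order_on_continuous:
  "second_order_on S \<phi> G H \<Longrightarrow> continuous_on S \<phi>"
  unfolding second_order_on_def
  by (meson has_derivative_continuous_on has_derivative_at_withinI)

lemma has_real_derivative_along_line:
  fixes f :: "'a::real_inner \<Rightarrow> real"
  assumes "(f has_derivative (\<lambda>h. g \<bullet> h)) (at (x + t *\<^sub>R d))"
  shows "((\<lambda>t. f (x + t *\<^sub>R d)) has_real_derivative g \<bullet> d) (at t)"
proof -
  have "((\<lambda>t. x + t *\<^sub>R d) has_derivative (\<lambda>s. s *\<^sub>R d)) (at t)"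
    by (auto intro!: derivative_eq_intros)
  then have "((\<lambda>t. f (x + t *\<^sub>R d)) has_derivative (\<lambda>s. g \<bullet> (s *\<^sub>R d))) (at t)"
    using assms by (rule has_derivative_compose)
  then show ?thesis
    unfolding has_field_derivative_def
    by (rule has_derivative_eq_rhs) (auto simp: mult.commute)
qed

lemma second_order_on_line:
  assumes "second_order_on S \<phi> G H" "x + t *\<^sub>R d \<in> S"
  shows "((\<lambda>t. \<phi> (x + t *\<^sub>R d)) has_real_derivative G (x + t *\<^sub>R d) \<bullet> d) (at t)"
  using assms unfolding second_order_on_def by (blast intro: has_real_derivative_along_line)

lemma second_order_on_add_scaled:
  assumes "second_order_on S \<phi> G H" "second_order_on S \<psi> G' H'"
  shows "second_order_on S (\<lambda>x. \<phi> x + c * \<psi> x) (\<lambda>x. G x + c *\<^sub>R G' x) (\<lambda>x. H x + c *\<^sub>R H' x)"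
  using assms unfolding second_order_on_def has_partial_def
  by (auto intro!: derivative_eq_intros simp: inner_add_left)

lemma second_derivative_at_max_nonpos:
  fixes h h' :: "real \<Rightarrow> real"
  assumes "d > 0"
    and h: "\<And>t. \<bar>t\<bar> < d \<Longrightarrow> (h has_real_derivative h' t) (at t)"
    and h': "(h' has_real_derivative k) (at 0)"
    and le: "\<And>t. \<bar>t\<bar> < d \<Longrightarrow> h t \<le> h 0"
  shows "h' 0 = 0 \<and> k \<le> 0"
proof -
  have h'0: "h' 0 = 0"
    by (rule DERIV_local_max[OF h[of 0] \<open>d > 0\<close>]) (use \<open>d > 0\<close> le in auto)
  moreover have "k \<le> 0"
  proof (rule ccontr)
    assume "\<not> k \<le> 0"
    then obtain e where "e > 0" and e: "\<And>t. 0 < t \<Longrightarrow> t < e \<Longrightarrow> h' 0 < h' t"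
      using DERIV_pos_inc_right[OF h'] by auto
    define t where "t = min d e / 2"
    have t: "0 < t" "t < d" "t < e" using \<open>d > 0\<close> \<open>e > 0\<close> unfolding t_def by auto
    have "h 0 < h t"
    proof (rule DERIV_pos_imp_increasing_open[OF \<open>0 < t\<close>])
      show "\<exists>y. (h has_real_derivative y) (at s) \<and> y > 0" if "0 < s" "s < t" for s
        using h[of s] e[of s] h'0 that t by (intro exI[of _ "h' s"]) auto
      show "continuous_on {0..t} h"
        by (intro continuous_at_imp_continuous_on ballI DERIV_isCont[OF h]) (use t in auto)
    qed
    then show False using le[of t] t by simp
  qed
  ultimately show ?thesis ..
qed

lemma interior_maximum:
  assumes "open S" "x \<in> S" and so: "second_order_on S \<phi> G H"
    and le: "\<And>y. y \<in> S \<Longrightarrow> \<phi> y \<le> \<phi> x"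
  shows "G x = 0" and "H x $ i \<le> 0"
proof -
  obtain d where "d > 0" and d: "ball x d \<subseteq> S"
    using \<open>open S\<close> \<open>x \<in> S\<close> openE by blast
  have inS: "x + t *\<^sub>R axis i 1 \<in> S" if "\<bar>t\<bar> < d" for t and i :: 'a
    using d that by (auto simp: dist_norm subset_iff)
  have *: "G x $ i = 0 \<and> H x $ i \<le> 0" for i
  proof -
    have der: "((\<lambda>t. \<phi> (x + t *\<^sub>R axis i 1)) has_real_derivative G (x + t *\<^sub>R axis i 1) $ i) (at t)"
      if "\<bar>t\<bar> < d" for t
      using second_order_on_line[OF so inS[OF that]] by (simp add: inner_axis)
    have der2: "((\<lambda>t. G (x + t *\<^sub>R axis i 1) $ i) has_real_derivative H x $ i) (at 0)"
      using so \<open>x \<in> S\<close> unfolding second_order_on_def has_partial_def by blast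
    have "\<phi> (x + t *\<^sub>R axis i 1) \<le> \<phi> (x + 0 *\<^sub>R axis i 1)" if "\<bar>t\<bar> < d" for t
      using le[OF inS[OF that]] by simp
    then show ?thesis
      using second_derivative_at_max_nonpos[OF \<open>d > 0\<close> der der2] by simp
  qed
  then show "G x = 0" "H x $ i \<le> 0" by (auto simp: vec_eq_iff)
qed

text \<open>
  The barrier of the Hopf lemma. For large \<open>\<alpha>\<close> and away from \<open>y\<close> the term with \<open>\<alpha>\<^sup>2\<close> dominates the
  second derivatives, which makes the Gaussian a strict subsolution of any operator
  \<open>\<Delta> + b \<bullet> \<nabla>\<close> with bounded \<open>b\<close>.
\<close>

lemma gaussian_second_order:
  fixes y :: "real ^ 'n::finite"
  shows "second_order_on S (\<lambda>x. exp (- (\<alpha> * (norm (x - y))\<^sup>2)))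
     (\<lambda>x. (- (2 * \<alpha> * exp (- (\<alpha> * (norm (x - y))\<^sup>2)))) *\<^sub>R (x - y))
     (\<lambda>x. \<chi> i. (4 * \<alpha>\<^sup>2 * ((x - y) $ i)\<^sup>2 - 2 * \<alpha>) * exp (- (\<alpha> * (norm (x - y))\<^sup>2)))"
proof -
  have 1: "((\<lambda>x. exp (- (\<alpha> * ((x - y) \<bullet> (x - y))))) has_derivative
     (\<lambda>h. (- (2 * \<alpha> * exp (- (\<alpha> * ((x - y) \<bullet> (x - y)))))) *\<^sub>R (x - y) \<bullet> h)) (at x)" for x
    by (auto intro!: derivative_eq_intros simp: inner_commute algebra_simps)
  have 2: "((\<lambda>t. ((- (2 * \<alpha> * exp (- (\<alpha> * ((x + t *\<^sub>R axis i 1 - y) \<bullet> (x + t *\<^sub>R axis i 1 - y)))))) *\<^sub>R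
        (x + t *\<^sub>R axis i 1 - y)) $ i) has_real_derivative
      (4 * \<alpha>\<^sup>2 * ((x - y) $ i)\<^sup>2 - 2 * \<alpha>) * exp (- (\<alpha> * ((x - y) \<bullet> (x - y))))) (at 0)" for x i
  proof -
    \<comment> \<open>Along the coordinate line the exponent is a polynomial in \<open>t\<close>,
        which can be differentiated mechanically.\<close>
    have e: "(x + t *\<^sub>R axis i 1 - y) \<bullet> (x + t *\<^sub>R axis i 1 - y) =
        (x - y) \<bullet> (x - y) + 2 * t * (x - y) $ i + t\<^sup>2" for t
    proof -
      have "x + t *\<^sub>R axis i 1 - y = (x - y) + t *\<^sub>R axis i 1" by simp
      then show ?thesis
        by (simp only: inner_add_left inner_add_right inner_scaleR_left inner_scaleR_right
            inner_axis_axis inner_axis inner_commute[of "axis i 1"])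
          (simp add: power2_eq_square algebra_simps)
    qed
    show ?thesis
      unfolding e
      by (auto intro!: derivative_eq_intros simp: power2_eq_square algebra_simps)
  qed
  show ?thesis
    unfolding second_order_on_def has_partial_def power2_norm_eq_inner
    by (intro ballI conjI allI 1) (use 2 in simp)
qed

section \<open>The lemma of Hopf and the strong maximum principle\<close>

text \<open>
  The lemma of Hopf, for a subsolution on a ball with a strict maximum at the point \<open>p\<close> of its
  sphere. On the annulus between the radii \<open>R / 2\<close> and \<open>R\<close> the function is compared with a small multiple
  of a Gaussian barrier. The barrier is constant on the outer sphere, and its radial slope there
  is nonzero; it pushes \<open>\<phi>\<close> below its maximum at least linearly along the radius. The conclusion
  is stated with a one-sided difference quotient, since \<open>p\<close> may be a boundary point of the domain of \<open>\<phi>\<close>.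
\<close>

lemma hopf_difference_quotient:
  fixes p y :: "real ^ 'n::finite"
  defines "R \<equiv> dist y p"
  assumes "R > 0"
    and cont: "continuous_on (cball y R) \<phi>"
    and so: "second_order_on (ball y R) \<phi> G H"
    and sub: "\<And>x. x \<in> ball y R \<Longrightarrow> 0 \<le> (\<Sum>i\<in>UNIV. H x $ i) + b x \<bullet> G x"
    and bnd: "\<And>x. x \<in> ball y R \<Longrightarrow> norm (b x) \<le> B"
    and less: "\<And>x. x \<in> ball y R \<Longrightarrow> \<phi> x < \<phi> p"
  shows "\<not> ((\<lambda>t. (\<phi> (p + t *\<^sub>R (y - p)) - \<phi> p) / t) \<longlongrightarrow> 0) (at_right 0)"
proof
  assume lim: "((\<lambda>t. (\<phi> (p + t *\<^sub>R (y - p)) - \<phi> p) / t) \<longlongrightarrow> 0) (at_right 0)"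
  have "B \<ge> 0" using bnd[of y] \<open>R > 0\<close> by (meson centre_in_ball norm_ge_zero order_trans)
  define n where "n = real CARD('n)"
  have "n > 0" unfolding n_def by simp
  \<comment> \<open>On the annulus \<open>2 \<alpha> r\<^sup>2 \<ge> \<alpha> R\<^sup>2 / 2\<close>,
      and this choice makes the right-hand side equal to \<open>2 (n + B R)\<close>, which
      exceeds the lower-order terms \<open>n + B R\<close>.\<close>
  define \<alpha> where "\<alpha> = 4 * (n + B * R) / R\<^sup>2"
  have "\<alpha> > 0" unfolding \<alpha>_def using \<open>n > 0\<close> \<open>B \<ge> 0\<close> \<open>R > 0\<close> by (simp add: add_pos_nonneg)
  define E where "E = (\<lambda>x. exp (- (\<alpha> * (norm (x - y))\<^sup>2)))"
  define G' where "G' = (\<lambda>x. (- (2 * \<alpha> * E x)) *\<^sub>R (x - y))"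
  define H' where "H' = (\<lambda>x. (\<chi> i. (4 * \<alpha>\<^sup>2 * ((x - y) $ i)\<^sup>2 - 2 * \<alpha>) * E x) :: real ^ 'n)"
  have soE: "second_order_on S E G' H'" for S
    unfolding E_def G'_def H'_def by (rule gaussian_second_order)
  have E_pos: "E x > 0" for x unfolding E_def by simp
  have sumH': "(\<Sum>i\<in>UNIV. H' x $ i) = (4 * \<alpha>\<^sup>2 * (norm (x - y))\<^sup>2 - 2 * \<alpha> * n) * E x" for x
  proof -
    have "(norm (x - y))\<^sup>2 = (\<Sum>i\<in>UNIV. ((x - y) $ i)\<^sup>2)"
      by (simp only: power2_norm_eq_inner inner_vec_def) (simp add: power2_eq_square)
    then show ?thesis
      by (simp add: H'_def n_def sum_distrib_left sum_distrib_right sum_subtractf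
          left_diff_distrib mult.assoc)
  qed
  have barrier: "0 < (\<Sum>i\<in>UNIV. H' x $ i) + b x \<bullet> G' x"
    if "R / 2 < dist y x" "dist y x < R" for x
  proof -
    define r where "r = norm (x - y)"
    have r: "R / 2 < r" "r < R" using that unfolding r_def by (simp_all add: dist_norm norm_minus_commute)
    have "\<bar>b x \<bullet> (x - y)\<bar> \<le> norm (b x) * r"
      unfolding r_def by (rule Cauchy_Schwarz_ineq2)
    also have "\<dots> \<le> B * r"
      using bnd[of x] that r \<open>R > 0\<close> by (intro mult_right_mono) auto
    also have "\<dots> \<le> B * R" using r \<open>B \<ge> 0\<close> by (intro mult_left_mono) auto
    finally have 1: "b x \<bullet> (x - y) \<le> B * R" by simp
    have "0 \<le> B * R" using \<open>B \<ge> 0\<close> \<open>R > 0\<close> by simp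
    then have "n + B * R < 2 * (n + B * R)" using \<open>n > 0\<close> by simp
    also have "\<dots> = 2 * \<alpha> * (R / 2)\<^sup>2"
      unfolding \<alpha>_def using \<open>R > 0\<close> by (simp add: power_divide)
    also have "\<dots> \<le> 2 * \<alpha> * r\<^sup>2"
      using r \<open>R > 0\<close> \<open>\<alpha> > 0\<close> by (intro mult_left_mono power_mono) auto
    finally have "0 < 2 * \<alpha> * r\<^sup>2 - n - b x \<bullet> (x - y)" using 1 by simp
    then have "0 < 2 * \<alpha> * E x * (2 * \<alpha> * r\<^sup>2 - n - b x \<bullet> (x - y))"
      using \<open>\<alpha> > 0\<close> E_pos[of x] by (intro mult_pos_pos) auto
    also have "\<dots> = (\<Sum>i\<in>UNIV. H' x $ i) + b x \<bullet> G' x"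
      unfolding sumH' G'_def r_def[symmetric] by (simp add: power2_eq_square algebra_simps)
    finally show ?thesis .
  qed
  have le: "\<phi> x \<le> \<phi> p" if "x \<in> cball y R" for x
    using continuous_le_on_closure[of "ball y R" \<phi> x "\<phi> p"] cont that less \<open>R > 0\<close>
    by (simp add: closure_ball less_imp_le)
  obtain q where q: "q \<in> cball y (R / 2)" "\<And>x. x \<in> cball y (R / 2) \<Longrightarrow> \<phi> x \<le> \<phi> q"
  proof -
    have "continuous_on (cball y (R / 2)) \<phi>"
      using \<open>R > 0\<close> by (intro continuous_on_subset[OF cont]) auto
    moreover have "cball y (R / 2) \<noteq> {}" using \<open>R > 0\<close> by simp
    ultimately show thesis
      using continuous_attains_sup[of "cball y (R / 2)" \<phi>] that by auto
  qed
  \<comment> \<open>As the Gaussian is at most 1, this gap on the inner sphere can serve as the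
      factor of the barrier.\<close>
  define \<delta> where "\<delta> = \<phi> p - \<phi> q"
  have "\<delta> > 0" using less[of q] q(1) \<open>R > 0\<close> unfolding \<delta>_def by auto
  define K where "K = exp (- (\<alpha> * R\<^sup>2))"
  define A where "A = {x. R / 2 \<le> dist y x \<and> dist y x \<le> R}"
  \<comment> \<open>The outer sphere and the inner sphere respect the bound, and an interior
      maximum of \<open>\<phi> + \<delta> E\<close> would contradict the strict inequality
      \<open>barrier\<close>.\<close>
  have below: "\<phi> x + \<delta> * E x \<le> \<phi> p + \<delta> * K" if "x \<in> A" for x
  proof -
    have A_eq: "A = cball y R - ball y (R / 2)" unfolding A_def by auto
    then have "compact A" by (simp add: compact_diff)
    moreover have "continuous_on A (\<lambda>x. \<phi> x + \<delta> * E x)"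
      unfolding E_def
      by (intro continuous_intros continuous_on_subset[OF cont]) (auto simp: A_def)
    ultimately obtain x0 where x0: "x0 \<in> A"
      and max: "\<And>x. x \<in> A \<Longrightarrow> \<phi> x + \<delta> * E x \<le> \<phi> x0 + \<delta> * E x0"
      using continuous_attains_sup[of A "\<lambda>x. \<phi> x + \<delta> * E x"] \<open>x \<in> A\<close> by blast
    have "\<phi> x0 + \<delta> * E x0 \<le> \<phi> p + \<delta> * K"
    proof -
      consider "dist y x0 = R" | "dist y x0 = R / 2" | "R / 2 < dist y x0" "dist y x0 < R"
        using x0 unfolding A_def by force
      then show ?thesis
      proof cases
        case 1
        then have "E x0 = K" unfolding E_def K_def by (simp add: dist_norm norm_minus_commute)
        then show ?thesis using le[of x0] 1 by simp
      next
        case 2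
        then have "\<phi> x0 \<le> \<phi> q" using q(2) by simp
        moreover have "E x0 \<le> 1" unfolding E_def using \<open>\<alpha> > 0\<close> by simp
        then have "\<delta> * E x0 \<le> \<delta>" using \<open>\<delta> > 0\<close> by (simp add: mult_left_le)
        moreover have "0 \<le> \<delta> * K" using \<open>\<delta> > 0\<close> unfolding K_def by simp
        ultimately show ?thesis unfolding \<delta>_def by linarith
      next
        case 3
        define S where "S = ball y R - cball y (R / 2)"
        have S: "open S" "x0 \<in> S" "S \<subseteq> A" "S \<subseteq> ball y R"
          using 3 unfolding S_def A_def by (auto simp: open_Diff)
        have soS: "second_order_on S (\<lambda>x. \<phi> x + \<delta> * E x)
            (\<lambda>x. G x + \<delta> *\<^sub>R G' x) (\<lambda>x. H x + \<delta> *\<^sub>R H' x)"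
          by (intro second_order_on_add_scaled second_order_on_subset[OF so] S soE)
        have G0: "G x0 + \<delta> *\<^sub>R G' x0 = 0"
          by (rule interior_maximum[OF S(1,2) soS]) (use S max in auto)
        have "(H x0 + \<delta> *\<^sub>R H' x0) $ i \<le> 0" for i
          by (rule interior_maximum[OF S(1,2) soS]) (use S max in auto)
        then have "(\<Sum>i\<in>UNIV. (H x0 + \<delta> *\<^sub>R H' x0) $ i) \<le> 0"
          by (intro sum_nonpos) auto
        then have "(\<Sum>i\<in>UNIV. H x0 $ i) + \<delta> * (\<Sum>i\<in>UNIV. H' x0 $ i) \<le> 0"
          by (simp add: sum.distrib sum_distrib_left)
        moreover have "b x0 \<bullet> G x0 + \<delta> * (b x0 \<bullet> G' x0) = 0"
          using arg_cong[OF G0, of "\<lambda>v. b x0 \<bullet> v"] by (simp add: inner_add_right)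
        moreover have "0 < \<delta> * ((\<Sum>i\<in>UNIV. H' x0 $ i) + b x0 \<bullet> G' x0)"
          using barrier[OF 3] \<open>\<delta> > 0\<close> by simp
        moreover have "0 \<le> (\<Sum>i\<in>UNIV. H x0 $ i) + b x0 \<bullet> G x0"
          using sub[of x0] S by auto
        ultimately show ?thesis by (simp add: distrib_left)
      qed
    qed
    then show ?thesis using max[OF \<open>x \<in> A\<close>] by linarith
  qed
  \<comment> \<open>The exponent gains \<open>\<alpha> R\<^sup>2 (2 t - t\<^sup>2)\<close> from
      the radius \<open>R\<close> to the radius \<open>(1 - t) R\<close>, hence a slope of at least
      \<open>c\<close>.\<close>
  define c where "c = \<delta> * K * (\<alpha> * R\<^sup>2)"
  have "c > 0" unfolding c_def K_def using \<open>\<delta> > 0\<close> \<open>\<alpha> > 0\<close> \<open>R > 0\<close> by simp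
  have slope: "(\<phi> (p + t *\<^sub>R (y - p)) - \<phi> p) / t \<le> - c" if t: "0 < t" "t < 1 / 2" for t
  proof -
    let ?x = "p + t *\<^sub>R (y - p)"
    have "?x - y = (1 - t) *\<^sub>R (p - y)" by (simp add: algebra_simps)
    then have "norm (?x - y) = \<bar>1 - t\<bar> * norm (p - y)" by (simp only: norm_scaleR)
    then have nx: "norm (?x - y) = (1 - t) * R"
      using t unfolding R_def by (simp add: dist_norm norm_minus_commute)
    have "1 / 2 * R \<le> (1 - t) * R" "(1 - t) * R \<le> 1 * R"
      using t \<open>R > 0\<close> by (intro mult_right_mono; simp)+
    then have "?x \<in> A"
      unfolding A_def using nx by (simp add: dist_commute dist_norm)
    then have "\<phi> ?x - \<phi> p \<le> \<delta> * (K - E ?x)"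
      using below by (force simp: right_diff_distrib)
    also have "E ?x = K * exp (\<alpha> * R\<^sup>2 * (2 * t - t\<^sup>2))"
      unfolding E_def K_def nx exp_add[symmetric] by (simp add: power2_eq_square algebra_simps)
    also have "\<delta> * (K - K * exp (\<alpha> * R\<^sup>2 * (2 * t - t\<^sup>2))) \<le> \<delta> * (K - K * (1 + \<alpha> * R\<^sup>2 * t))"
    proof -
      have "t * t \<le> 1 * t" using t by (intro mult_right_mono) auto
      then have "\<alpha> * R\<^sup>2 * t \<le> \<alpha> * R\<^sup>2 * (2 * t - t\<^sup>2)"
        using \<open>\<alpha> > 0\<close> by (intro mult_left_mono) (auto simp: power2_eq_square)
      then have "1 + \<alpha> * R\<^sup>2 * t \<le> exp (\<alpha> * R\<^sup>2 * (2 * t - t\<^sup>2))"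
        using exp_ge_add_one_self[of "\<alpha> * R\<^sup>2 * (2 * t - t\<^sup>2)"] by linarith
      then show ?thesis
        using \<open>\<delta> > 0\<close> unfolding K_def by (intro mult_left_mono diff_left_mono) auto
    qed
    also have "\<dots> = - c * t" unfolding c_def by (simp add: algebra_simps)
    finally show ?thesis using t by (simp add: divide_le_eq)
  qed
  have "\<forall>\<^sub>F t::real in at_right 0. 0 < t \<and> t < 1 / 2"
    unfolding eventually_at_right_field by (intro exI[of _ "1/2"]) auto
  then have "\<forall>\<^sub>F t in at_right 0. (\<phi> (p + t *\<^sub>R (y - p)) - \<phi> p) / t \<le> - c"
    by eventually_elim (use slope in blast)
  then have "0 \<le> - c"
    using lim by (intro tendsto_upperbound) auto
  then show False using \<open>c > 0\<close> by simp
qed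

text \<open>
  The set of maximum points is relatively closed; if it were not open, some point \<open>q\<close> outside it
  would have a nearest maximum point \<open>p\<close> well inside \<open>\<Omega>\<close>. The ball about \<open>q\<close> through \<open>p\<close> then falls under
  the lemma of Hopf, although the gradient vanishes at the interior maximum \<open>p\<close>.
\<close>

lemma strong_maximum_principle:
  fixes \<Omega> :: "(real ^ 'n::finite) set"
  assumes "open \<Omega>" "connected \<Omega>"
    and so: "second_order_on \<Omega> \<phi> G H"
    and sub: "\<And>x. x \<in> \<Omega> \<Longrightarrow> 0 \<le> (\<Sum>i\<in>UNIV. H x $ i) + b x \<bullet> G x"
    and bnd: "\<And>x. x \<in> \<Omega> \<Longrightarrow> norm (b x) \<le> B"
    and le: "\<And>x. x \<in> \<Omega> \<Longrightarrow> \<phi> x \<le> M"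
    and "x0 \<in> \<Omega>" "\<phi> x0 = M" "x \<in> \<Omega>"
  shows "\<phi> x = M"
proof -
  note cont = second_order_on_continuous[OF so]
  define S where "S = {x \<in> \<Omega>. \<phi> x = M}"
  have "closedin (top_of_set \<Omega>) S"
    unfolding S_def using cont by (rule continuous_closedin_preimage_constant)
  moreover have "openin (top_of_set \<Omega>) S"
  proof -
    have "open S"
      unfolding open_contains_ball
    proof
      fix a assume "a \<in> S"
      then have "a \<in> \<Omega>" "\<phi> a = M" unfolding S_def by auto
      obtain r where "r > 0" and r: "cball a r \<subseteq> \<Omega>"
        using \<open>open \<Omega>\<close> \<open>a \<in> \<Omega>\<close> open_contains_cball by blast
      \<comment> \<open>The radius is halved so that the touching ball, no larger than the distance
          from \<open>q\<close> to \<open>a\<close>, still lies in the ball of radius \<open>r\<close>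
          about \<open>a\<close>.\<close>
      have "ball a (r / 2) \<subseteq> S"
      proof
        fix q assume q: "q \<in> ball a (r / 2)"
        show "q \<in> S"
        proof (rule ccontr)
          assume "q \<notin> S"
          define Z where "Z = {x \<in> cball a r. \<phi> x = M}"
          have "continuous_on (cball a r) \<phi>" using cont r by (rule continuous_on_subset)
          then have "closed Z"
            unfolding Z_def by (intro continuous_closed_preimage_constant) auto
          moreover have "a \<in> Z" unfolding Z_def using \<open>\<phi> a = M\<close> \<open>r > 0\<close> by simp
          ultimately obtain p where "p \<in> Z" and p: "\<And>z. z \<in> Z \<Longrightarrow> dist q p \<le> dist q z"
            using distance_attains_inf[of Z q] by blast
          have "p \<in> \<Omega>" "\<phi> p = M" using \<open>p \<in> Z\<close> r unfolding Z_def by auto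
          have "dist q p \<le> dist q a" using p \<open>a \<in> Z\<close> by blast
          also have "\<dots> < r / 2" using q by (simp add: dist_commute)
          finally have qp: "dist q p < r / 2" .
          have "cball q (dist q p) \<subseteq> cball a r"
          proof
            fix x assume "x \<in> cball q (dist q p)"
            then show "x \<in> cball a r"
              using dist_triangle[of a x q] q qp by simp
          qed
          with r have sub\<Omega>: "cball q (dist q p) \<subseteq> \<Omega>" by blast
          then have bsub: "ball q (dist q p) \<subseteq> \<Omega>" using ball_subset_cball by blast
          have "p \<noteq> q" using \<open>q \<notin> S\<close> \<open>p \<in> \<Omega>\<close> \<open>\<phi> p = M\<close> unfolding S_def by blast
          have less: "\<phi> x < \<phi> p" if "x \<in> ball q (dist q p)" for x
          proof -
            have "x \<notin> Z" using p[of x] that by auto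
            then have "\<phi> x \<noteq> M"
              using that \<open>cball q (dist q p) \<subseteq> cball a r\<close> ball_subset_cball
              unfolding Z_def by blast
            then show ?thesis using le[of x] bsub that \<open>\<phi> p = M\<close> by force
          qed
          have "G p = 0"
            by (rule interior_maximum(1)[OF \<open>open \<Omega>\<close> \<open>p \<in> \<Omega>\<close> so]) (simp add: \<open>\<phi> p = M\<close> le)
          then have "((\<lambda>t. \<phi> (p + t *\<^sub>R (q - p))) has_real_derivative 0) (at 0)"
            using second_order_on_line[OF so, of p 0 "q - p"] \<open>p \<in> \<Omega>\<close> by simp
          then have "((\<lambda>t. (\<phi> (p + t *\<^sub>R (q - p)) - \<phi> p) / t) \<longlongrightarrow> 0) (at 0)"
            by (simp add: has_field_derivative_iff)
          then have "((\<lambda>t. (\<phi> (p + t *\<^sub>R (q - p)) - \<phi> p) / t) \<longlongrightarrow> 0) (at_right 0)"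
            by (rule filterlim_mono) (auto simp: at_le)
          moreover have "\<not> ((\<lambda>t. (\<phi> (p + t *\<^sub>R (q - p)) - \<phi> p) / t) \<longlongrightarrow> 0) (at_right 0)"
          proof (rule hopf_difference_quotient[of q p \<phi> G H b B])
            show "0 < dist q p" using \<open>p \<noteq> q\<close> by simp
            show "continuous_on (cball q (dist q p)) \<phi>"
              using cont sub\<Omega> by (rule continuous_on_subset)
            show "second_order_on (ball q (dist q p)) \<phi> G H"
              using so bsub by (rule second_order_on_subset)
          qed (use bsub sub bnd less in auto)
          ultimately show False by contradiction
        qed
      qed
      then show "\<exists>e>0. ball a e \<subseteq> S" using \<open>r > 0\<close> by (intro exI[of _ "r / 2"]) auto
    qed
    then show ?thesis by (simp add: openin_open_eq[OF \<open>open \<Omega>\<close>] S_def)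
  qed
  moreover have "x0 \<in> S" using \<open>x0 \<in> \<Omega>\<close> \<open>\<phi> x0 = M\<close> unfolding S_def by simp
  ultimately have "S = \<Omega>" using \<open>connected \<Omega>\<close> unfolding connected_clopen by blast
  then show ?thesis using \<open>x \<in> \<Omega>\<close> unfolding S_def by blast
qed

section \<open>The Neumann problem on smooth domains\<close>

text \<open>
  The first derivatives are differentiable at \<open>p\<close>, so the gradient deviates from its value at \<open>p\<close> at
  most linearly; the mean value theorem along the segment then gives the quadratic remainder.
\<close>

lemma C2_quadratic_upper_bound:
  fixes \<rho> :: "real ^ 'n::finite \<Rightarrow> real"
  assumes "open U" "p \<in> U" and C2: "C_k_on 2 U \<rho>"
  obtains r C where "r > 0" "C \<ge> 0" "ball p r \<subseteq> U"
    "\<And>x. x \<in> ball p r \<Longrightarrow> \<rho> x \<le> \<rho> p + gradient \<rho> p \<bullet> (x - p) + C * (norm (x - p))\<^sup>2"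
proof -
  have diff: "\<rho> differentiable (at x)" "partial_deriv i \<rho> differentiable (at x)" if "x \<in> U" for x i
    using C2 that by (auto simp: numeral_2_eq_2)
  have "\<exists>K. \<forall>\<^sub>F x in nhds p. \<bar>partial_deriv i \<rho> x - partial_deriv i \<rho> p\<bar> \<le> K * norm (x - p)" for i
  proof -
    let ?f = "partial_deriv i \<rho>"
    obtain D where D: "(?f has_derivative D) (at p)"
      using diff(2)[OF \<open>p \<in> U\<close>] unfolding differentiable_def by blast
    obtain d where "d > 0" and d: "\<And>x. norm (x - p) < d \<Longrightarrow> norm (?f x - ?f p - D (x - p)) \<le> 1 * norm (x - p)"
      using D unfolding has_derivative_at_alt by (metis zero_less_one)
    obtain K where K: "\<And>h. norm (D h) \<le> norm h * K"
      using bounded_linear.bounded[OF has_derivative_bounded_linear[OF D]] by blast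
    have "\<bar>?f x - ?f p\<bar> \<le> (K + 1) * norm (x - p)" if "norm (x - p) < d" for x
      using d[OF that] K[of "x - p"] by (simp add: algebra_simps)
    then have "\<forall>\<^sub>F x in nhds p. \<bar>?f x - ?f p\<bar> \<le> (K + 1) * norm (x - p)"
      unfolding eventually_nhds_metric dist_norm using \<open>d > 0\<close> by blast
    then show ?thesis ..
  qed
  then obtain K where
    "\<And>i. \<forall>\<^sub>F x in nhds p. \<bar>partial_deriv i \<rho> x - partial_deriv i \<rho> p\<bar> \<le> K i * norm (x - p)"
    by metis
  then have "\<forall>\<^sub>F x in nhds p. \<forall>i. \<bar>partial_deriv i \<rho> x - partial_deriv i \<rho> p\<bar> \<le> K i * norm (x - p)"
    by (rule eventually_all_finite)
  moreover have "\<forall>\<^sub>F x in nhds p. x \<in> U" using \<open>open U\<close> \<open>p \<in> U\<close> by (rule eventually_nhds_in_open)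
  ultimately have "\<forall>\<^sub>F x in nhds p. x \<in> U \<and>
      (\<forall>i. \<bar>partial_deriv i \<rho> x - partial_deriv i \<rho> p\<bar> \<le> K i * norm (x - p))"
    by eventually_elim blast
  then obtain r where "r > 0" and r: "\<And>x. x \<in> ball p r \<Longrightarrow> x \<in> U"
      "\<And>x i. x \<in> ball p r \<Longrightarrow> \<bar>partial_deriv i \<rho> x - partial_deriv i \<rho> p\<bar> \<le> K i * norm (x - p)"
    unfolding eventually_nhds_metric by (auto simp: dist_commute)
  define C where "C = (\<Sum>i\<in>UNIV. \<bar>K i\<bar>)"
  have "C \<ge> 0" unfolding C_def by (simp add: sum_nonneg)
  have grad: "norm (gradient \<rho> x - gradient \<rho> p) \<le> C * norm (x - p)" if "x \<in> ball p r" for x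
  proof -
    have "norm (gradient \<rho> x - gradient \<rho> p) \<le> (\<Sum>i\<in>UNIV. \<bar>(gradient \<rho> x - gradient \<rho> p) $ i\<bar>)"
      by (rule norm_le_l1_cart)
    also have "\<dots> \<le> (\<Sum>i\<in>UNIV. \<bar>K i\<bar> * norm (x - p))"
    proof (rule sum_mono)
      fix i :: 'n
      have "\<bar>(gradient \<rho> x - gradient \<rho> p) $ i\<bar> \<le> K i * norm (x - p)"
        using r(2)[OF that, of i] by (simp add: gradient_def)
      also have "\<dots> \<le> \<bar>K i\<bar> * norm (x - p)" by (intro mult_right_mono) auto
      finally show "\<bar>(gradient \<rho> x - gradient \<rho> p) $ i\<bar> \<le> \<bar>K i\<bar> * norm (x - p)" .
    qed
    finally show ?thesis unfolding C_def by (simp add: sum_distrib_right)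
  qed
  have "\<rho> x \<le> \<rho> p + gradient \<rho> p \<bullet> (x - p) + C * (norm (x - p))\<^sup>2" if x: "x \<in> ball p r" for x
  proof -
    have seg: "p + t *\<^sub>R (x - p) \<in> ball p r" if "0 \<le> t" "t \<le> 1" for t
    proof -
      have "t * norm (x - p) \<le> 1 * norm (x - p)" using that by (intro mult_right_mono) auto
      then show ?thesis using x that by (simp add: dist_norm norm_minus_commute)
    qed
    have der: "((\<lambda>t. \<rho> (p + t *\<^sub>R (x - p))) has_real_derivative
        gradient \<rho> (p + t *\<^sub>R (x - p)) \<bullet> (x - p)) (at t)" if "0 \<le> t" "t \<le> 1" for t
      using seg[OF that] r(1)
      by (intro has_real_derivative_along_line gradient_has_derivative diff(1)) auto
    obtain t where t: "0 < t" "t < 1"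
      and eq: "\<rho> x - \<rho> p = gradient \<rho> (p + t *\<^sub>R (x - p)) \<bullet> (x - p)"
      using MVT2[of 0 1, OF _ der] by auto
    define \<xi> where "\<xi> = p + t *\<^sub>R (x - p)"
    have \<xi>: "\<xi> \<in> ball p r" "\<rho> x - \<rho> p = gradient \<rho> \<xi> \<bullet> (x - p)"
      unfolding \<xi>_def using seg[of t] t eq by auto
    have "norm (\<xi> - p) \<le> norm (x - p)"
      unfolding \<xi>_def using t by (simp add: mult_left_le_one_le)
    have "(gradient \<rho> \<xi> - gradient \<rho> p) \<bullet> (x - p) \<le> norm (gradient \<rho> \<xi> - gradient \<rho> p) * norm (x - p)"
      by (rule norm_cauchy_schwarz)
    also have "\<dots> \<le> (C * norm (x - p)) * norm (x - p)"
    proof (rule mult_right_mono)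
      have "norm (gradient \<rho> \<xi> - gradient \<rho> p) \<le> C * norm (\<xi> - p)"
        using grad \<xi>(1) by blast
      also have "\<dots> \<le> C * norm (x - p)"
        using \<open>norm (\<xi> - p) \<le> norm (x - p)\<close> \<open>C \<ge> 0\<close> by (rule mult_left_mono)
      finally show "norm (gradient \<rho> \<xi> - gradient \<rho> p) \<le> C * norm (x - p)" .
    qed simp
    finally show ?thesis
      using \<xi>(2) by (simp add: inner_diff_left power2_eq_square mult.assoc)
  qed
  then show thesis using that \<open>r > 0\<close> \<open>C \<ge> 0\<close> r(1) by blast
qed

text \<open>
  In the ball, \<open>\<nu> \<bullet> (x - p) < - |x - p|\<^sup>2 / (2 R)\<close>. For small \<open>R\<close> this linear gain outweighs the
  quadratic error of the defining function \<open>\<rho>\<close>, so that \<open>\<rho> < 0\<close>.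
\<close>

lemma interior_sphere:
  fixes \<Omega> :: "(real ^ 'n::finite) set"
  assumes "open \<Omega>" "p \<in> frontier \<Omega>" and ldf: "local_defining_function \<Omega> p U \<rho>"
  obtains R where "R > 0" "ball (p - R *\<^sub>R outward_normal \<Omega> p) R \<subseteq> \<Omega>"
proof -
  let ?g = "gradient \<rho> p" and ?\<nu> = "outward_normal \<Omega> p"
  have U: "open U" "p \<in> U" "\<Omega> \<inter> U = {x \<in> U. \<rho> x < 0}" "?g \<noteq> 0" "C_k_on 2 U \<rho>"
    using ldf unfolding local_defining_function_def smooth_on_def by auto
  have \<nu>: "?\<nu> = sgn ?g" by (rule outward_normal_eq[OF assms])
  then have "norm ?\<nu> = 1" and g\<nu>: "?g = norm ?g *\<^sub>R ?\<nu>"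
    using U(4) by (simp_all add: norm_sgn sgn_div_norm)
  obtain r C where "r > 0" "C \<ge> 0" and r: "ball p r \<subseteq> U"
    and quad: "\<And>x. x \<in> ball p r \<Longrightarrow> \<rho> x \<le> \<rho> p + ?g \<bullet> (x - p) + C * (norm (x - p))\<^sup>2"
    using C2_quadratic_upper_bound[OF U(1,2,5)] by blast
  \<comment> \<open>The bound \<open>r / 2\<close> keeps the whole ball, of diameter \<open>2 R\<close>,
      where the expansion is valid; the other bound makes the linear term win.\<close>
  define R where "R = min (r / 2) (norm ?g / (2 * (C + 1)))"
  have "R > 0" unfolding R_def using \<open>r > 0\<close> \<open>C \<ge> 0\<close> U(4) by simp
  have "2 * R * (C + 1) \<le> norm ?g"
  proof -
    have "R \<le> norm ?g / (2 * (C + 1))" unfolding R_def by simp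
    then show ?thesis using \<open>C \<ge> 0\<close> by (simp add: field_simps)
  qed
  have "ball (p - R *\<^sub>R ?\<nu>) R \<subseteq> \<Omega>"
  proof
    fix x assume "x \<in> ball (p - R *\<^sub>R ?\<nu>) R"
    then have near: "norm ((x - p) + R *\<^sub>R ?\<nu>) < R"
      by (simp add: dist_norm norm_minus_commute algebra_simps)
    define s where "s = (norm (x - p))\<^sup>2"
    have "(norm ((x - p) + R *\<^sub>R ?\<nu>))\<^sup>2 < R\<^sup>2"
      using near by (intro power_strict_mono) auto
    moreover have "(norm ((x - p) + R *\<^sub>R ?\<nu>))\<^sup>2 = s + 2 * R * (?\<nu> \<bullet> (x - p)) + R\<^sup>2"
    proof -
      have "?\<nu> \<bullet> ?\<nu> = 1" using \<open>norm ?\<nu> = 1\<close> by (simp add: norm_eq_1)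
      then show ?thesis
        unfolding s_def power2_norm_eq_inner
        by (simp add: inner_add_left inner_add_right inner_commute power2_eq_square)
    qed
    ultimately have half: "s + 2 * R * (?\<nu> \<bullet> (x - p)) < 0" by simp
    have "norm (x - p) \<le> norm ((x - p) + R *\<^sub>R ?\<nu>) + norm (R *\<^sub>R ?\<nu>)"
      using norm_triangle_ineq4[of "(x - p) + R *\<^sub>R ?\<nu>" "R *\<^sub>R ?\<nu>"] by simp
    also have "\<dots> < R + R" using near \<open>norm ?\<nu> = 1\<close> \<open>R > 0\<close> by simp
    also have "\<dots> \<le> r" unfolding R_def by simp
    finally have x: "x \<in> ball p r" by (simp add: dist_norm norm_minus_commute)
    have "s \<ge> 0" unfolding s_def by simp
    have neg: "?\<nu> \<bullet> (x - p) < 0"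
      using half \<open>s \<ge> 0\<close> \<open>R > 0\<close> by (smt (verit) mult_nonneg_nonneg)
    have "?g \<bullet> (x - p) = norm ?g * (?\<nu> \<bullet> (x - p))"
      by (subst g\<nu>) simp
    also have "\<dots> \<le> 2 * R * (C + 1) * (?\<nu> \<bullet> (x - p))"
      using \<open>2 * R * (C + 1) \<le> norm ?g\<close> neg by (intro mult_right_mono_neg) auto
    also have "\<dots> = (C + 1) * (2 * R * (?\<nu> \<bullet> (x - p)))" by simp
    also have "\<dots> < (C + 1) * (- s)"
      using half \<open>C \<ge> 0\<close> by (intro mult_strict_left_mono) auto
    finally have "?g \<bullet> (x - p) + C * s < - s" by (simp add: algebra_simps)
    then have "\<rho> x < 0"
      using quad[OF x] local_defining_function_zero[OF assms] \<open>s \<ge> 0\<close> unfolding s_def by linarith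
    then show "x \<in> \<Omega>" using U(3) x r by blast
  qed
  then show thesis using that \<open>R > 0\<close> by blast
qed

text \<open>
  At a boundary point \<open>\<phi>\<close> need not be differentiable, since only the limit of its gradient is known
  there. The mean value theorem converts that limit into a one-sided derivative.
\<close>

lemma difference_quotient_into_domain:
  fixes p d :: "real ^ 'n::finite"
  assumes cont: "continuous_on (closure \<Omega>) \<phi>" and so: "second_order_on \<Omega> \<phi> G H"
    and "p \<in> closure \<Omega>" and inside: "\<And>t. 0 < t \<Longrightarrow> t < 1 \<Longrightarrow> p + t *\<^sub>R d \<in> \<Omega>"
    and "p \<notin> \<Omega>" and lim: "(G \<longlongrightarrow> g) (at p within \<Omega>)"
  shows "((\<lambda>t. (\<phi> (p + t *\<^sub>R d) - \<phi> p) / t) \<longlongrightarrow> g \<bullet> d) (at_right 0)"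
proof -
  have "((\<lambda>t. G (p + t *\<^sub>R d)) \<longlongrightarrow> g) (at_right 0)"
  proof (rule filterlim_compose[OF lim])
    have "((\<lambda>t. p + t *\<^sub>R d) \<longlongrightarrow> p + 0 *\<^sub>R d) (at_right 0)" by (intro tendsto_intros)
    moreover have "\<forall>\<^sub>F t in at_right (0::real). p + t *\<^sub>R d \<in> \<Omega> \<and> p + t *\<^sub>R d \<noteq> p"
      unfolding eventually_at_right_field
      using inside \<open>p \<notin> \<Omega>\<close> by (intro exI[of _ 1]) force
    ultimately show "filterlim (\<lambda>t. p + t *\<^sub>R d) (at p within \<Omega>) (at_right 0)"
      unfolding filterlim_at by (simp add: conj_commute eventually_mono)
  qed
  then have Gd: "((\<lambda>t. G (p + t *\<^sub>R d) \<bullet> d) \<longlongrightarrow> g \<bullet> d) (at_right 0)"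
    by (intro tendsto_intros)
  show ?thesis
  proof (rule tendstoI)
    fix e :: real assume "e > 0"
    then have "\<forall>\<^sub>F t in at_right 0. dist (G (p + t *\<^sub>R d) \<bullet> d) (g \<bullet> d) < e"
      using Gd by (rule tendstoD[rotated])
    then obtain \<tau> where "\<tau> > 0" and \<tau>: "\<And>t. 0 < t \<Longrightarrow> t < \<tau> \<Longrightarrow> dist (G (p + t *\<^sub>R d) \<bullet> d) (g \<bullet> d) < e"
      unfolding eventually_at_right_field by blast
    have "dist ((\<phi> (p + t *\<^sub>R d) - \<phi> p) / t) (g \<bullet> d) < e" if t: "0 < t" "t < min \<tau> 1" for t
    proof -
      let ?\<gamma> = "\<lambda>t. \<phi> (p + t *\<^sub>R d)"
      have der: "(?\<gamma> has_real_derivative G (p + s *\<^sub>R d) \<bullet> d) (at s)" if "0 < s" "s < t" for s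
        by (rule second_order_on_line[OF so]) (use inside that t in auto)
      have mem: "p + s *\<^sub>R d \<in> closure \<Omega>" if "s \<in> {0..t}" for s
      proof (cases "s = 0")
        case False
        then have "p + s *\<^sub>R d \<in> \<Omega>" using that t inside by auto
        then show ?thesis using closure_subset by blast
      qed (simp add: \<open>p \<in> closure \<Omega>\<close>)
      have "continuous_on {0..t} ?\<gamma>"
        by (rule continuous_on_compose2[OF cont]) (use mem in \<open>auto intro!: continuous_intros\<close>)
      then obtain l s where s: "0 < s" "s < t" and l: "(?\<gamma> has_real_derivative l) (at s)"
        and eq: "?\<gamma> t - ?\<gamma> 0 = (t - 0) * l"
        using MVT[OF \<open>0 < t\<close>, of ?\<gamma>] der real_differentiable_def by blast
      have "l = G (p + s *\<^sub>R d) \<bullet> d" using DERIV_unique[OF l der[OF s]] .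
      then have "(\<phi> (p + t *\<^sub>R d) - \<phi> p) / t = G (p + s *\<^sub>R d) \<bullet> d"
        using eq t by simp
      then show ?thesis using \<tau>[of s] s t by simp
    qed
    then show "\<forall>\<^sub>F t in at_right 0. dist ((\<phi> (p + t *\<^sub>R d) - \<phi> p) / t) (g \<bullet> d) < e"
      unfolding eventually_at_right_field using \<open>\<tau> > 0\<close> by (intro exI[of _ "min \<tau> 1"]) auto
  qed
qed

text \<open>
  Uniqueness for the Neumann problem up to constants. A maximum attained only on the boundary is
  excluded by the lemma of Hopf on an interior tangent ball: the quotient along the inner normal
  would tend to a multiple of the normal derivative, that is, to zero. A maximum inside propagates
  by the strong maximum principle.
\<close>

lemma neumann_subsolution_constant:
  fixes \<Omega> :: "(real ^ 'n::finite) set"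
  assumes dom: "smooth_bounded_domain \<Omega>"
    and cont: "continuous_on (closure \<Omega>) \<phi>"
    and so: "second_order_on \<Omega> \<phi> G H"
    and sub: "\<And>x. x \<in> \<Omega> \<Longrightarrow> 0 \<le> (\<Sum>i\<in>UNIV. H x $ i) + b x \<bullet> G x"
    and bnd: "\<And>x. x \<in> \<Omega> \<Longrightarrow> norm (b x) \<le> B"
    and flux: "\<And>p. p \<in> frontier \<Omega> \<Longrightarrow>
       \<exists>g. (G \<longlongrightarrow> g) (at p within \<Omega>) \<and> outward_normal \<Omega> p \<bullet> g = 0"
  shows "\<phi> constant_on closure \<Omega>"
proof (cases "\<Omega> = {}")
  case False
  have \<Omega>: "open \<Omega>" "connected \<Omega>" "bounded \<Omega>"
    using dom unfolding smooth_bounded_domain_def by auto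
  have "compact (closure \<Omega>)" using \<Omega> by simp
  moreover have "closure \<Omega> \<noteq> {}" using False by simp
  ultimately obtain p where p: "p \<in> closure \<Omega>" and max: "\<And>x. x \<in> closure \<Omega> \<Longrightarrow> \<phi> x \<le> \<phi> p"
    using continuous_attains_sup[OF _ _ cont] by blast
  have "\<exists>x0\<in>\<Omega>. \<phi> x0 = \<phi> p"
  proof (rule ccontr)
    assume none: "\<not> (\<exists>x0\<in>\<Omega>. \<phi> x0 = \<phi> p)"
    have less: "\<phi> x < \<phi> p" if "x \<in> \<Omega>" for x
      using none max[of x] that closure_subset by force
    have "p \<notin> \<Omega>" using none by blast
    then have "p \<in> frontier \<Omega>" using p \<Omega>(1) by (simp add: frontier_def interior_open)
    then obtain U \<rho> where ldf: "local_defining_function \<Omega> p U \<rho>"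
      using dom unfolding smooth_bounded_domain_def by blast
    define \<nu> where "\<nu> = outward_normal \<Omega> p"
    obtain R where "R > 0" and R: "ball (p - R *\<^sub>R \<nu>) R \<subseteq> \<Omega>"
      using interior_sphere[OF \<Omega>(1) \<open>p \<in> frontier \<Omega>\<close> ldf] unfolding \<nu>_def by blast
    have "norm \<nu> = 1"
      using ldf unfolding \<nu>_def outward_normal_eq[OF \<Omega>(1) \<open>p \<in> frontier \<Omega>\<close> ldf]
      by (simp add: norm_sgn local_defining_function_def)
    define y where "y = p - R *\<^sub>R \<nu>"
    have yp: "dist y p = R" unfolding y_def using \<open>norm \<nu> = 1\<close> \<open>R > 0\<close> by (simp add: dist_norm)
    have ball: "ball y (dist y p) \<subseteq> \<Omega>" using R yp unfolding y_def by simp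
    then have "closure (ball y (dist y p)) \<subseteq> closure \<Omega>" by (rule closure_mono)
    then have cball: "cball y (dist y p) \<subseteq> closure \<Omega>" using yp \<open>R > 0\<close> by simp
    obtain g where g: "(G \<longlongrightarrow> g) (at p within \<Omega>)" "\<nu> \<bullet> g = 0"
      using flux[OF \<open>p \<in> frontier \<Omega>\<close>] unfolding \<nu>_def by blast
    have "p + t *\<^sub>R (y - p) \<in> \<Omega>" if "0 < t" "t < 1" for t
    proof -
      have "y - (p + t *\<^sub>R (y - p)) = (1 - t) *\<^sub>R (y - p)" by (simp add: algebra_simps)
      then have "dist y (p + t *\<^sub>R (y - p)) = (1 - t) * dist y p"
        using that by (simp add: dist_norm)
      also have "\<dots> < dist y p" using that yp \<open>R > 0\<close> by simp
      finally show ?thesis using ball by auto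
    qed
    then have "((\<lambda>t. (\<phi> (p + t *\<^sub>R (y - p)) - \<phi> p) / t) \<longlongrightarrow> g \<bullet> (y - p)) (at_right 0)"
      using difference_quotient_into_domain[OF cont so p _ \<open>p \<notin> \<Omega>\<close> g(1)] by blast
    moreover have "g \<bullet> (y - p) = 0" using g(2) unfolding y_def by (simp add: inner_commute)
    moreover have "\<not> ((\<lambda>t. (\<phi> (p + t *\<^sub>R (y - p)) - \<phi> p) / t) \<longlongrightarrow> 0) (at_right 0)"
    proof (rule hopf_difference_quotient[of y p \<phi> G H b B])
      show "0 < dist y p" using yp \<open>R > 0\<close> by simp
      show "continuous_on (cball y (dist y p)) \<phi>" using cont cball by (rule continuous_on_subset)
      show "second_order_on (ball y (dist y p)) \<phi> G H" using so ball by (rule second_order_on_subset)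
    qed (use ball sub bnd less in auto)
    ultimately show False by simp
  qed
  then obtain x0 where x0: "x0 \<in> \<Omega>" "\<phi> x0 = \<phi> p" by blast
  have "\<phi> x = \<phi> p" if "x \<in> \<Omega>" for x
    by (rule strong_maximum_principle[OF \<Omega>(1,2) so sub bnd _ x0 that])
      (use max closure_subset in auto)
  then have "\<phi> x = \<phi> p" if "x \<in> closure \<Omega>" for x
    by (rule continuous_constant_on_closure[OF cont _ that])
  then show ?thesis unfolding constant_on_def by blast
qed (simp add: constant_on_def)

section \<open>Equilibria without flux\<close>

lemma has_partial_differentiable:
  assumes "f differentiable (at x)"
  shows "has_partial i f (partial_deriv i f x) x"
proof -
  have "(f has_derivative (\<lambda>h. gradient f x \<bullet> h)) (at (x + 0 *\<^sub>R axis i 1))"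
    using gradient_has_derivative[OF assms] by simp
  from has_real_derivative_along_line[OF this] show ?thesis
    by (simp add: has_partial_def inner_axis gradient_def)
qed

lemma has_partial_eq_partial_deriv:
  assumes "has_partial i f c x" "f differentiable (at x)"
  shows "partial_deriv i f x = c"
  using has_partial_differentiable[OF assms(2), of i] assms(1)
  unfolding has_partial_def by (rule DERIV_unique)

lemma C2_closure_differentiable:
  assumes "C2_closure \<Omega> f" "x \<in> \<Omega>"
  shows "f differentiable (at x)" "partial_deriv i f differentiable (at x)"
  using assms by (auto simp: C2_closure_def numeral_2_eq_2)

lemma C2_closure_gradient_tendsto:
  assumes "C2_closure \<Omega> f" "p \<in> closure \<Omega>"
  obtains l where "(gradient f \<longlongrightarrow> l) (at p within \<Omega>)"
proof -
  have "\<forall>i. \<exists>g. continuous_on (closure \<Omega>) g \<and> (\<forall>x\<in>\<Omega>. g x = partial_deriv i f x)"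
    using assms(1) unfolding C2_closure_def extends_continuously_def by blast
  then obtain g where g: "\<And>i. continuous_on (closure \<Omega>) (g i)"
      "\<And>i x. x \<in> \<Omega> \<Longrightarrow> g i x = partial_deriv i f x"
    by metis
  have "((\<lambda>x. gradient f x $ i) \<longlongrightarrow> g i p) (at p within \<Omega>)" for i
  proof -
    have "(g i \<longlongrightarrow> g i p) (at p within closure \<Omega>)"
      using g(1) assms(2) unfolding continuous_on_def by blast
    then have "(g i \<longlongrightarrow> g i p) (at p within \<Omega>)"
      using closure_subset by (rule tendsto_within_subset)
    moreover have "\<forall>\<^sub>F x in at p within \<Omega>. g i x = gradient f x $ i"
      by (simp add: eventually_at_filter g(2) gradient_def)
    ultimately show ?thesis by (rule Lim_transform_eventually)
  qed
  then have "(gradient f \<longlongrightarrow> (\<chi> i. g i p)) (at p within \<Omega>)"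
    by (intro vec_tendstoI) simp
  then show thesis by (rule that)
qed

lemma C2_closure_gradient_bounded:
  assumes "bounded \<Omega>" "C2_closure \<Omega> f"
  obtains B where "\<And>x. x \<in> \<Omega> \<Longrightarrow> norm (gradient f x) \<le> B"
proof -
  have "\<exists>B. \<forall>x\<in>\<Omega>. \<bar>partial_deriv i f x\<bar> \<le> B" for i
  proof -
    obtain g where g: "continuous_on (closure \<Omega>) g" "\<And>x. x \<in> \<Omega> \<Longrightarrow> g x = partial_deriv i f x"
      using assms(2) unfolding C2_closure_def extends_continuously_def by metis
    have "bounded (g ` closure \<Omega>)"
      using g(1) assms(1) by (intro compact_imp_bounded compact_continuous_image) auto
    then obtain B where "\<forall>x\<in>closure \<Omega>. \<bar>g x\<bar> \<le> B"
      unfolding bounded_iff by auto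
    then have "\<forall>x\<in>\<Omega>. \<bar>partial_deriv i f x\<bar> \<le> B"
      using g(2) closure_subset by (metis subsetD)
    then show ?thesis ..
  qed
  then obtain B where B: "\<And>i x. x \<in> \<Omega> \<Longrightarrow> \<bar>partial_deriv i f x\<bar> \<le> B i" by metis
  have "norm (gradient f x) \<le> (\<Sum>i\<in>UNIV. B i)" if "x \<in> \<Omega>" for x
  proof -
    have "norm (gradient f x) \<le> (\<Sum>i\<in>UNIV. \<bar>gradient f x $ i\<bar>)" by (rule norm_le_l1_cart)
    also have "\<dots> \<le> (\<Sum>i\<in>UNIV. B i)"
      using B[OF that] by (intro sum_mono) (simp add: gradient_def)
    finally show ?thesis .
  qed
  then show thesis by (rule that)
qed

lemma normal_derivative_eq:
  assumes "open \<Omega>" "p \<in> frontier \<Omega>" "(gradient f \<longlongrightarrow> l) (at p within \<Omega>)"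
  shows "normal_derivative \<Omega> f p = outward_normal \<Omega> p \<bullet> l"
proof -
  have "p islimpt \<Omega>"
    using assms(1,2) by (auto simp: frontier_def interior_open closure_def)
  then have "Lim (at p within \<Omega>) (gradient f) = l"
    by (intro tendsto_Lim assms(3)) (simp add: trivial_limit_within)
  then show ?thesis unfolding normal_derivative_def by simp
qed

text \<open>
  The flux \<open>D \<nabla>u + k u \<nabla>w\<close> is \<open>D exp (- a w) \<nabla>(u exp (a w))\<close> with \<open>a = k / D\<close>. If it is divergence free and
  has no normal component on the boundary, then \<open>u exp (a w)\<close> solves a homogeneous Neumann problem and is constant.
\<close>

lemma no_flux_equilibrium:
  fixes \<Omega> :: "(real ^ 'n::finite) set"
  assumes dom: "smooth_bounded_domain \<Omega>" and "D > 0"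
    and u: "C2_closure \<Omega> u" and w: "C2_closure \<Omega> w"
    and pde: "\<And>x. x \<in> \<Omega> \<Longrightarrow>
      0 = D * laplacian u x + k * divergence (\<lambda>y. u y *\<^sub>R gradient w y) x"
    and bc: "\<And>x. x \<in> frontier \<Omega> \<Longrightarrow>
      D * normal_derivative \<Omega> u x + k * u x * normal_derivative \<Omega> w x = 0"
  obtains c where "\<And>x. x \<in> closure \<Omega> \<Longrightarrow> u x = c * exp (- (k / D * w x))"
proof -
  have \<Omega>: "open \<Omega>" "bounded \<Omega>" using dom unfolding smooth_bounded_domain_def by auto
  define a where "a = k / D"
  define \<phi> where "\<phi> = (\<lambda>x. u x * exp (a * w x))"
  define G where "G = (\<lambda>x. exp (a * w x) *\<^sub>R (gradient u x + (a * u x) *\<^sub>R gradient w x))"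
  \<comment> \<open>The summands of the divergence of \<open>\<nabla>u + a u \<nabla>w\<close>,
      with product rule applied.\<close>
  define J where "J = (\<lambda>x i. partial_deriv i (partial_deriv i u) x +
    a * (partial_deriv i u x * partial_deriv i w x + u x * partial_deriv i (partial_deriv i w) x))"
  define H where "H = (\<lambda>x. (\<chi> i. exp (a * w x) * J x i + a * partial_deriv i w x * G x $ i) :: real ^ 'n)"
  have cont: "continuous_on (closure \<Omega>) u" "continuous_on (closure \<Omega>) w"
    using u w unfolding C2_closure_def by auto
  have so: "second_order_on \<Omega> \<phi> G H"
    unfolding second_order_on_def
  proof (intro ballI conjI allI)
    fix x i assume x: "x \<in> \<Omega>"
    have "(u has_derivative (\<lambda>h. gradient u x \<bullet> h)) (at x)"
         "(w has_derivative (\<lambda>h. gradient w x \<bullet> h)) (at x)"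
      using u w x by (auto intro: gradient_has_derivative C2_closure_differentiable)
    then show "(\<phi> has_derivative (\<lambda>h. G x \<bullet> h)) (at x)"
      unfolding \<phi>_def G_def
      by (auto intro!: derivative_eq_intros simp: inner_add_left algebra_simps)
    have d: "has_partial i u (partial_deriv i u x) x" "has_partial i w (partial_deriv i w x) x"
      "has_partial i (partial_deriv i u) (partial_deriv i (partial_deriv i u) x) x"
      "has_partial i (partial_deriv i w) (partial_deriv i (partial_deriv i w) x) x"
      using u w x by (auto intro!: has_partial_differentiable C2_closure_differentiable)
    show "has_partial i (\<lambda>y. G y $ i) (H x $ i) x"
      using d unfolding has_partial_def G_def H_def J_def
      by (auto simp: gradient_def intro!: derivative_eq_intros) (simp add: algebra_simps)
  qed
  have div: "divergence (\<lambda>y. u y *\<^sub>R gradient w y) x =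
      (\<Sum>i\<in>UNIV. partial_deriv i u x * partial_deriv i w x + u x * partial_deriv i (partial_deriv i w) x)"
    if x: "x \<in> \<Omega>" for x
    unfolding divergence_def
  proof (rule sum.cong[OF refl])
    fix i :: 'n
    have d: "u differentiable (at x)" "partial_deriv i w differentiable (at x)"
      using u w x by (auto intro: C2_closure_differentiable)
    have "has_partial i (\<lambda>y. u y * partial_deriv i w y)
        (partial_deriv i u x * partial_deriv i w x + u x * partial_deriv i (partial_deriv i w) x) x"
      using d[THEN has_partial_differentiable, of i] unfolding has_partial_def
      by (auto intro!: derivative_eq_intros)
    then have "partial_deriv i (\<lambda>y. u y * partial_deriv i w y) x =
        partial_deriv i u x * partial_deriv i w x + u x * partial_deriv i (partial_deriv i w) x"
      using d by (intro has_partial_eq_partial_deriv differentiable_mult)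
    then show "partial_deriv i (\<lambda>y. (u y *\<^sub>R gradient w y) $ i) x =
        partial_deriv i u x * partial_deriv i w x + u x * partial_deriv i (partial_deriv i w) x"
      by (simp add: gradient_def)
  qed
  \<comment> \<open>The choice \<open>b = - a \<nabla>w\<close> cancels the derivative of the
      factor \<open>exp (a w)\<close> and leaves the divergence of the flux.\<close>
  have eq: "(\<Sum>i\<in>UNIV. H x $ i) + ((- a) *\<^sub>R gradient w x) \<bullet> G x = 0" if x: "x \<in> \<Omega>" for x
  proof -
    have "(\<Sum>i\<in>UNIV. H x $ i) + ((- a) *\<^sub>R gradient w x) \<bullet> G x = exp (a * w x) * (\<Sum>i\<in>UNIV. J x i)"
      by (simp add: H_def inner_vec_def gradient_def sum.distrib sum_distrib_left sum_negf mult.assoc)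
    also have "(\<Sum>i\<in>UNIV. J x i) = laplacian u x + a * divergence (\<lambda>y. u y *\<^sub>R gradient w y) x"
      unfolding div[OF x] J_def laplacian_def
      by (simp add: sum.distrib distrib_left sum_distrib_left)
    also have "\<dots> = 0"
      using pde[OF x] \<open>D > 0\<close> unfolding a_def by (simp add: field_simps)
    finally show ?thesis by simp
  qed
  obtain B where B: "\<And>x. x \<in> \<Omega> \<Longrightarrow> norm (gradient w x) \<le> B"
    using C2_closure_gradient_bounded[OF \<Omega>(2) w] by blast
  have "\<phi> constant_on closure \<Omega>"
  proof (rule neumann_subsolution_constant[OF dom _ so])
    show "continuous_on (closure \<Omega>) \<phi>"
      unfolding \<phi>_def by (intro continuous_intros cont)
    show "norm ((- a) *\<^sub>R gradient w x) \<le> \<bar>a\<bar> * B" if "x \<in> \<Omega>" for x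
      using B[OF that] by (simp add: mult_left_mono)
    show "0 \<le> (\<Sum>i\<in>UNIV. H x $ i) + ((- a) *\<^sub>R gradient w x) \<bullet> G x" if "x \<in> \<Omega>" for x
      using eq[OF that] by simp
    show "\<exists>g. (G \<longlongrightarrow> g) (at p within \<Omega>) \<and> outward_normal \<Omega> p \<bullet> g = 0" if p: "p \<in> frontier \<Omega>" for p
    proof -
      have pc: "p \<in> closure \<Omega>" using p by (simp add: frontier_def)
      obtain lu where lu: "(gradient u \<longlongrightarrow> lu) (at p within \<Omega>)"
        using C2_closure_gradient_tendsto[OF u pc] by blast
      obtain lw where lw: "(gradient w \<longlongrightarrow> lw) (at p within \<Omega>)"
        using C2_closure_gradient_tendsto[OF w pc] by blast
      have "(u \<longlongrightarrow> u p) (at p within \<Omega>)" "(w \<longlongrightarrow> w p) (at p within \<Omega>)"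
        using cont pc closure_subset unfolding continuous_on_def
        by (blast intro: tendsto_within_subset)+
      then have "(G \<longlongrightarrow> exp (a * w p) *\<^sub>R (lu + (a * u p) *\<^sub>R lw)) (at p within \<Omega>)"
        unfolding G_def by (intro tendsto_intros lu lw)
      moreover have "outward_normal \<Omega> p \<bullet> lu + a * u p * (outward_normal \<Omega> p \<bullet> lw) = 0"
        using bc[OF p] \<open>D > 0\<close>
        unfolding normal_derivative_eq[OF \<Omega>(1) p lu] normal_derivative_eq[OF \<Omega>(1) p lw] a_def
        by (simp add: field_simps)
      then have "outward_normal \<Omega> p \<bullet> (exp (a * w p) *\<^sub>R (lu + (a * u p) *\<^sub>R lw)) = 0"
        by (simp add: inner_add_right)
      ultimately show ?thesis by blast
    qed
  qed
  then obtain c where c: "\<And>x. x \<in> closure \<Omega> \<Longrightarrow> \<phi> x = c"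
    unfolding constant_on_def by blast
  have "u x = c * exp (- (k / D * w x))" if "x \<in> closure \<Omega>" for x
    using c[OF that, symmetric] unfolding \<phi>_def a_def[symmetric] by (simp flip: exp_add add: mult.assoc)
  then show thesis by (rule that)
qed

section \<open>Real analytic functions and the identity theorem\<close>

text \<open>
  Real analyticity at a point, expressed by a holomorphic extension rather than by a power series:
  composition then needs no rearrangement of series, and isolation of zeros is inherited from
  complex analysis. The equation is demanded near \<open>a\<close> only, so that \<open>h\<close> may be arbitrary elsewhere.
\<close>

definition complex_extendable_at :: "(real \<Rightarrow> real) \<Rightarrow> real \<Rightarrow> bool" where
  "complex_extendable_at h a \<longleftrightarrow>
     (\<exists>F. F analytic_on {complex_of_real a} \<and>
       (\<forall>\<^sub>F x in nhds a. F (complex_of_real x) = complex_of_real (h x)))"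

lemma real_analytic_on_complex_extendable:
  assumes "real_analytic_on h S" "a \<in> S"
  shows "complex_extendable_at h a"
proof -
  obtain r c where "r > 0" and c: "\<And>x. x \<in> ball a r \<Longrightarrow> (\<lambda>k. c k * (x - a) ^ k) sums h x"
    using assms unfolding real_analytic_on_def by blast
  define F where "F = (\<lambda>\<zeta>. \<Sum>k. complex_of_real (c k) * (\<zeta> - complex_of_real a) ^ k)"
  have "(\<lambda>k. complex_of_real (c k) * (\<zeta> - complex_of_real a) ^ k) sums F \<zeta>"
    if \<zeta>: "\<zeta> \<in> ball (complex_of_real a) r" for \<zeta>
  proof -
    \<comment> \<open>The coefficients are controlled at real points only, so compare with the real
        point \<open>a + \<rho>\<close>, where \<open>\<zeta>\<close> is strictly closer to
        \<open>a\<close>.\<close>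
    obtain \<rho> where \<rho>: "norm (\<zeta> - complex_of_real a) < \<rho>" "\<rho> < r"
      using \<zeta> dense[of "norm (\<zeta> - complex_of_real a)" r]
      by (metis dist_commute dist_norm mem_ball)
    then have "0 < \<rho>" by (meson norm_ge_zero le_less_trans)
    then have "a + \<rho> \<in> ball a r" using \<rho> by (simp add: dist_norm)
    then have "summable (\<lambda>k. c k * \<rho> ^ k)" using c[of "a + \<rho>"] by (auto simp: sums_iff)
    then have "summable (\<lambda>k. complex_of_real (c k * \<rho> ^ k))"
      by (rule summable_of_real)
    then have "summable (\<lambda>k. complex_of_real (c k) * complex_of_real \<rho> ^ k)"
      by (simp only: of_real_mult of_real_power)
    then have "summable (\<lambda>k. complex_of_real (c k) * (\<zeta> - complex_of_real a) ^ k)"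
      by (rule powser_inside) (use \<rho> \<open>0 < \<rho>\<close> in simp)
    then show ?thesis unfolding F_def by (rule summable_sums)
  qed
  then have "F analytic_on ball (complex_of_real a) r"
    by (rule power_series_analytic)
  then have "F analytic_on {complex_of_real a}"
    using \<open>r > 0\<close> by (auto elim: analytic_on_subset)
  moreover have "F (complex_of_real x) = complex_of_real (h x)" if "x \<in> ball a r" for x
  proof -
    have "(\<lambda>k. complex_of_real (c k * (x - a) ^ k)) sums complex_of_real (h x)"
      using c[OF that] by (rule sums_of_real)
    then show ?thesis unfolding F_def by (simp add: sums_iff)
  qed
  then have "\<forall>\<^sub>F x in nhds a. F (complex_of_real x) = complex_of_real (h x)"
    using \<open>r > 0\<close> unfolding eventually_nhds by (intro exI[of _ "ball a r"]) auto
  ultimately show ?thesis unfolding complex_extendable_at_def by blast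
qed

lemma complex_extendable_compose:
  assumes "complex_extendable_at h a" "complex_extendable_at k (h a)"
  shows "complex_extendable_at (\<lambda>x. k (h x)) a"
proof -
  obtain F where F: "F analytic_on {complex_of_real a}"
    and Fh: "\<forall>\<^sub>F x in nhds a. F (complex_of_real x) = complex_of_real (h x)"
    using assms(1) unfolding complex_extendable_at_def by blast
  obtain K where K: "K analytic_on {complex_of_real (h a)}"
    and Kk: "\<forall>\<^sub>F y in nhds (h a). K (complex_of_real y) = complex_of_real (k y)"
    using assms(2) unfolding complex_extendable_at_def by blast
  have Fa: "F (complex_of_real a) = complex_of_real (h a)"
    using Fh by (rule eventually_nhds_x_imp_x)
  have "isCont F (complex_of_real a)"
    using F by (rule analytic_at_imp_isCont)
  then have "isCont (\<lambda>x. Re (F (complex_of_real x))) a"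
    by (intro isCont_Re isCont_o2[OF isCont_of_real[OF continuous_ident]])
  then have "((\<lambda>x. Re (F (complex_of_real x))) \<longlongrightarrow> Re (F (complex_of_real a))) (nhds a)"
    using tendsto_at_iff_tendsto_nhds[of "\<lambda>x. Re (F (complex_of_real x))" a]
    unfolding isCont_def by blast
  then have "((\<lambda>x. Re (F (complex_of_real x))) \<longlongrightarrow> h a) (nhds a)"
    unfolding Fa Re_complex_of_real .
  moreover have "\<forall>\<^sub>F x in nhds a. Re (F (complex_of_real x)) = h x"
    using Fh by eventually_elim simp
  ultimately have "(h \<longlongrightarrow> h a) (nhds a)"
    by (rule Lim_transform_eventually)
  then have "\<forall>\<^sub>F x in nhds a. K (complex_of_real (h x)) = complex_of_real (k (h x))"
    using Kk by (rule filterlim_iff[THEN iffD1, rule_format])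
  with Fh have "\<forall>\<^sub>F x in nhds a. (K \<circ> F) (complex_of_real x) = complex_of_real (k (h x))"
    by eventually_elim simp
  moreover have "(K \<circ> F) analytic_on {complex_of_real a}"
    using F K by (intro analytic_on_compose) (simp_all add: Fa)
  ultimately show ?thesis unfolding complex_extendable_at_def by blast
qed

lemma complex_extendable_scaled_exp: "complex_extendable_at (\<lambda>y. c * exp (- (k * y))) a"
proof -
  let ?E = "\<lambda>\<zeta>. complex_of_real c * exp (- (complex_of_real k * \<zeta>))"
  have "?E analytic_on {complex_of_real a}"
    by (intro analytic_intros)
  moreover have "?E (complex_of_real x) = complex_of_real (c * exp (- (k * x)))" for x
    by (simp flip: exp_of_real)
  ultimately show ?thesis
    unfolding complex_extendable_at_def by (intro exI[of _ ?E]) simp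
qed

lemma complex_extendable_minus_ident:
  assumes "complex_extendable_at h a"
  shows "complex_extendable_at (\<lambda>x. h x - x) a"
proof -
  obtain F where F: "F analytic_on {complex_of_real a}"
    "\<forall>\<^sub>F x in nhds a. F (complex_of_real x) = complex_of_real (h x)"
    using assms(1) unfolding complex_extendable_at_def by blast
  have "(\<lambda>\<zeta>. F \<zeta> - \<zeta>) analytic_on {complex_of_real a}"
    by (intro analytic_intros F)
  moreover have "\<forall>\<^sub>F x in nhds a. F (complex_of_real x) - complex_of_real x = complex_of_real (h x - x)"
    using F(2) by eventually_elim simp
  ultimately show ?thesis unfolding complex_extendable_at_def by blast
qed

text \<open>
  Zeros of the holomorphic extension are isolated unless it vanishes identically near \<open>a\<close>; restricting
  to the real line keeps this alternative.
\<close>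

lemma complex_extendable_zero_dichotomy:
  assumes "complex_extendable_at h a"
  shows "(\<forall>\<^sub>F x in nhds a. h x = 0) \<or> (\<forall>\<^sub>F x in at a. h x \<noteq> 0)"
proof -
  obtain F where F: "F analytic_on {complex_of_real a}"
    and Fh: "\<forall>\<^sub>F x in nhds a. F (complex_of_real x) = complex_of_real (h x)"
    using assms(1) unfolding complex_extendable_at_def by blast
  have lim: "filterlim complex_of_real (at (complex_of_real a)) (at a)"
    by (rule filterlim_atI) (auto intro!: tendsto_intros simp: eventually_at_filter)
  have Fh': "\<forall>\<^sub>F x in at a. F (complex_of_real x) = complex_of_real (h x)"
    using Fh by (simp add: eventually_at_filter eventually_mono)
  show ?thesis
  proof (cases "\<exists>\<^sub>F \<zeta> in at (complex_of_real a). F \<zeta> = 0")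
    case True
    have "isolated_singularity_at F (complex_of_real a)" "not_essential F (complex_of_real a)"
      using F by (auto intro: isolated_singularity_at_analytic not_essential_analytic)
    then have "\<forall>\<^sub>F \<zeta> in at (complex_of_real a). F \<zeta> = 0"
      using True by (rule not_essential_frequently_0_imp_eventually_0)
    moreover from this have "F (complex_of_real a) = 0"
    proof -
      have "(F \<longlongrightarrow> F (complex_of_real a)) (at (complex_of_real a))"
        using analytic_at_imp_isCont[OF F] by (simp add: isCont_def)
      moreover have "(F \<longlongrightarrow> 0) (at (complex_of_real a))"
        using \<open>\<forall>\<^sub>F \<zeta> in at (complex_of_real a). F \<zeta> = 0\<close> by (rule tendsto_eventually)
      ultimately show ?thesis by (metis tendsto_unique at_neq_bot)
    qed
    ultimately have "\<forall>\<^sub>F \<zeta> in nhds (complex_of_real a). F \<zeta> = 0"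
      by (simp add: eventually_nhds_conv_at)
    moreover have "filterlim complex_of_real (nhds (complex_of_real a)) (nhds a)"
      by (intro tendsto_intros filterlim_ident)
    ultimately have "\<forall>\<^sub>F x in nhds a. F (complex_of_real x) = 0"
      unfolding filterlim_iff by blast
    with Fh have "\<forall>\<^sub>F x in nhds a. h x = 0" by eventually_elim simp
    then show ?thesis ..
  next
    case False
    then have "\<forall>\<^sub>F \<zeta> in at (complex_of_real a). F \<zeta> \<noteq> 0"
      by (simp add: not_frequently)
    then have "\<forall>\<^sub>F x in at a. F (complex_of_real x) \<noteq> 0"
      using lim unfolding filterlim_iff by blast
    with Fh' have "\<forall>\<^sub>F x in at a. h x \<noteq> 0" by eventually_elim auto
    then show ?thesis ..
  qed
qed

text \<open>
  The two alternatives of the dichotomy divide \<open>I\<close> into two disjoint open sets, and the midpoint of the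
  given interval lies in the one where \<open>h\<close> vanishes locally; connectedness does the rest.
\<close>

lemma complex_extendable_identity:
  assumes "open I" "connected I"
    and ext: "\<And>a. a \<in> I \<Longrightarrow> complex_extendable_at h a"
    and "m < M" "{m<..<M} \<subseteq> I" and zero: "\<And>x. x \<in> {m<..<M} \<Longrightarrow> h x = 0"
    and "b \<in> I"
  shows "h b = 0"
proof -
  define Z where "Z = {a \<in> I. \<forall>\<^sub>F x in nhds a. h x = 0}"
  define N where "N = {a \<in> I. \<forall>\<^sub>F x in at a. h x \<noteq> 0}"
  have "open Z"
    unfolding open_subopen[of Z]
  proof
    fix a assume "a \<in> Z"
    then obtain T where T: "open T" "a \<in> T" "\<forall>x\<in>T. h x = 0" "a \<in> I"
      unfolding Z_def eventually_nhds by blast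
    then show "\<exists>T. open T \<and> a \<in> T \<and> T \<subseteq> Z"
      using \<open>open I\<close> unfolding Z_def eventually_nhds
      by (intro exI[of _ "T \<inter> I"]) auto
  qed
  moreover have "open N"
    unfolding open_subopen[of N]
  proof
    fix a assume "a \<in> N"
    then obtain T where T: "open T" "a \<in> T" "\<forall>x\<in>T. x \<noteq> a \<longrightarrow> h x \<noteq> 0" "a \<in> I"
      unfolding N_def eventually_at_topological by blast
    have "T \<inter> I \<subseteq> N"
    proof
      fix y assume y: "y \<in> T \<inter> I"
      show "y \<in> N"
      proof (cases "y = a")
        case False
        have "open (T - {a})" using T by (simp add: open_delete)
        moreover have "\<forall>x\<in>T - {a}. h x \<noteq> 0" using T by auto
        ultimately show ?thesis
          using y False unfolding N_def eventually_at_topological by blast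
      qed (use \<open>a \<in> N\<close> in simp)
    qed
    then show "\<exists>T. open T \<and> a \<in> T \<and> T \<subseteq> N"
      using T \<open>open I\<close> by (intro exI[of _ "T \<inter> I"]) auto
  qed
  moreover have "Z \<inter> N \<inter> I = {}"
  proof -
    have "a \<notin> N" if "a \<in> Z" for a
    proof
      assume "a \<in> N"
      then have "\<forall>\<^sub>F x in at a. h x \<noteq> 0" unfolding N_def by simp
      moreover have "\<forall>\<^sub>F x in at a. h x = 0"
        using that by (simp add: Z_def eventually_nhds_conv_at)
      ultimately have "\<forall>\<^sub>F x in at a. False" by eventually_elim simp
      then show False by simp
    qed
    then show ?thesis by blast
  qed
  moreover have "I \<subseteq> Z \<union> N"
    using complex_extendable_zero_dichotomy[OF ext] unfolding Z_def N_def by blast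
  ultimately have "Z \<inter> I = {} \<or> N \<inter> I = {}"
    using \<open>connected I\<close> by (intro connectedD)
  moreover have "(m + M) / 2 \<in> Z"
  proof -
    have "(m + M) / 2 \<in> {m<..<M}" using \<open>m < M\<close> by simp
    then have "\<forall>\<^sub>F x in nhds ((m + M) / 2). h x = 0"
      using zero unfolding eventually_nhds by (intro exI[of _ "{m<..<M}"]) auto
    then show ?thesis
      using \<open>(m + M) / 2 \<in> {m<..<M}\<close> \<open>{m<..<M} \<subseteq> I\<close> unfolding Z_def by blast
  qed
  ultimately have "b \<in> Z"
    using \<open>I \<subseteq> Z \<union> N\<close> \<open>b \<in> I\<close> unfolding Z_def by blast
  then show ?thesis unfolding Z_def by (auto dest: eventually_nhds_x_imp_x)
qed

section \<open>Constancy of stationary solutions\<close>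

text \<open>
  If all points between \<open>m\<close> and \<open>M\<close> were fixed, \<open>P\<close> would be the identity by analytic continuation,
  which is incompatible with an upper bound on \<open>P\<close>.
\<close>

lemma bounded_analytic_fixed_points_discrete:
  fixes P :: "real \<Rightarrow> real"
  assumes ext: "\<And>s. s > - \<epsilon> \<Longrightarrow> complex_extendable_at P s"
    and bound: "\<And>s. s > - \<epsilon> \<Longrightarrow> P s \<le> c"
    and "m \<ge> - \<epsilon>" "m < M"
  obtains s where "m < s" "s < M" "P s \<noteq> s"
proof -
  \<comment> \<open>Any point of the half-line above the bound \<open>c\<close> refutes \<open>P b = b\<close>;
      the maximum with \<open>M\<close> puts \<open>b\<close> into the half-line.\<close>
  define b where "b = max (c + 1) M"
  have "P b - b = 0" if zero: "\<And>s. s \<in> {m<..<M} \<Longrightarrow> P s - s = 0"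
    by (rule complex_extendable_identity[of "{- \<epsilon><..}" "\<lambda>s. P s - s" m M])
      (use assms zero in \<open>auto simp: b_def intro: complex_extendable_minus_ident\<close>)
  moreover have "P b - b < 0"
    using bound[of b] \<open>m \<ge> - \<epsilon>\<close> \<open>m < M\<close> unfolding b_def by linarith
  ultimately show thesis using that by force
qed

theorem proposition1p4:
  fixes \<Omega> :: "(real ^ 'n::finite) set"
    and D\<^sub>u D\<^sub>v \<chi>\<^sub>u \<chi>\<^sub>v \<epsilon> :: real
    and f g :: "real \<Rightarrow> real"
    and u v w z :: "real ^ 'n \<Rightarrow> real"
  assumes "smooth_bounded_domain \<Omega>"
    and "D\<^sub>u > 0" "D\<^sub>v > 0" "\<chi>\<^sub>u > 0" "\<chi>\<^sub>v > 0"
    and "\<epsilon> > 0"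
    and "real_analytic_on f {-\<epsilon><..}" "real_analytic_on g {-\<epsilon><..}"
    and "\<And>s. s > -\<epsilon> \<Longrightarrow> f s \<ge> 0" "\<And>s. s > -\<epsilon> \<Longrightarrow> g s \<ge> 0"
    and "C2_closure \<Omega> u" "C2_closure \<Omega> v" "C2_closure \<Omega> w" "C2_closure \<Omega> z"
    and "\<And>x. x \<in> closure \<Omega> \<Longrightarrow> u x \<ge> 0 \<and> v x \<ge> 0 \<and> w x \<ge> 0 \<and> z x \<ge> 0"
    and "\<And>x. x \<in> \<Omega> \<Longrightarrow>
           0 = D\<^sub>u * laplacian u x + \<chi>\<^sub>u * divergence (\<lambda>y. u y *\<^sub>R gradient w y) x"
    and "\<And>x. x \<in> \<Omega> \<Longrightarrow>
           0 = D\<^sub>v * laplacian v x + \<chi>\<^sub>v * divergence (\<lambda>y. v y *\<^sub>R gradient z y) x"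
    and "\<And>x. x \<in> \<Omega> \<Longrightarrow> 0 = - w x + f (v x)"
    and "\<And>x. x \<in> \<Omega> \<Longrightarrow> 0 = - z x + g (u x)"
    and "\<And>x. x \<in> frontier \<Omega> \<Longrightarrow>
           D\<^sub>u * normal_derivative \<Omega> u x + \<chi>\<^sub>u * u x * normal_derivative \<Omega> w x = 0"
    and "\<And>x. x \<in> frontier \<Omega> \<Longrightarrow>
           D\<^sub>v * normal_derivative \<Omega> v x + \<chi>\<^sub>v * v x * normal_derivative \<Omega> z x = 0"
  shows "u constant_on closure \<Omega> \<and> v constant_on closure \<Omega> \<and>
         w constant_on closure \<Omega> \<and> z constant_on closure \<Omega>"
proof (cases "\<Omega> = {}")
  case False
  then obtain x\<^sub>0 where x\<^sub>0: "x\<^sub>0 \<in> \<Omega>" by blast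
  define a where "a = \<chi>\<^sub>u / D\<^sub>u"
  define b where "b = \<chi>\<^sub>v / D\<^sub>v"
  have "a > 0" using assms(2,4) unfolding a_def by simp
  obtain c\<^sub>u where "\<And>x. x \<in> closure \<Omega> \<Longrightarrow> u x = c\<^sub>u * exp (- (a * w x))"
    using no_flux_equilibrium[OF assms(1,2,11,13,16,20)] unfolding a_def by blast
  then have u: "u x = c\<^sub>u * exp (- (a * f (v x)))" if "x \<in> \<Omega>" for x
    using assms(18)[OF that] that closure_subset by force
  obtain c\<^sub>v where "\<And>x. x \<in> closure \<Omega> \<Longrightarrow> v x = c\<^sub>v * exp (- (b * z x))"
    using no_flux_equilibrium[OF assms(1,3,12,14,17,21)] unfolding b_def by blast
  then have v: "v x = c\<^sub>v * exp (- (b * g (u x)))" if "x \<in> \<Omega>" for x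
    using assms(19)[OF that] that closure_subset by force
  have nonneg: "u x \<ge> 0" "v x \<ge> 0" if "x \<in> \<Omega>" for x
    using assms(15) that closure_subset by blast+
  have "c\<^sub>u \<ge> 0"
    using nonneg(1)[OF x\<^sub>0] unfolding u[OF x\<^sub>0] by (simp add: zero_le_mult_iff)
  have "c\<^sub>v \<ge> 0"
    using nonneg(2)[OF x\<^sub>0] unfolding v[OF x\<^sub>0] by (simp add: zero_le_mult_iff)
  \<comment> \<open>Eliminating \<open>v\<close> from the two formulas leaves the fixed point
      equation \<open>P u = u\<close>.\<close>
  define Q where "Q = (\<lambda>s. c\<^sub>v * exp (- (b * g s)))"
  define P where "P = (\<lambda>s. c\<^sub>u * exp (- (a * f (Q s))))"
  \<comment> \<open>\<open>Q\<close> maps into the interval on which \<open>f\<close> is analytic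
      and nonnegative.\<close>
  have Q: "Q s > - \<epsilon>" for s
    using \<open>c\<^sub>v \<ge> 0\<close> \<open>\<epsilon> > 0\<close> unfolding Q_def by (smt (verit) exp_ge_zero mult_nonneg_nonneg)
  have P_ext: "complex_extendable_at P s" if "s > - \<epsilon>" for s
  proof -
    have "complex_extendable_at g s"
      by (rule real_analytic_on_complex_extendable[OF assms(8)]) (use that in simp)
    from complex_extendable_compose[OF this complex_extendable_scaled_exp[of c\<^sub>v b]]
    have "complex_extendable_at Q s" unfolding Q_def .
    moreover have "complex_extendable_at f (Q s)"
      by (rule real_analytic_on_complex_extendable[OF assms(7)]) (use Q in simp)
    ultimately have "complex_extendable_at (\<lambda>s. f (Q s)) s"
      by (rule complex_extendable_compose)
    from complex_extendable_compose[OF this complex_extendable_scaled_exp[of c\<^sub>u a]]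
    show ?thesis unfolding P_def .
  qed
  have P_bound: "P s \<le> c\<^sub>u" for s
  proof -
    have "exp (- (a * f (Q s))) \<le> 1"
      using assms(9)[OF Q] \<open>a > 0\<close> by simp
    then show ?thesis unfolding P_def using \<open>c\<^sub>u \<ge> 0\<close> by (simp add: mult_left_le)
  qed
  have fixed: "P (u x) = u x" if "x \<in> \<Omega>" for x
  proof -
    have "Q (u x) = v x" unfolding Q_def by (rule v[OF that, symmetric])
    then show ?thesis by (simp only: P_def u[OF that, symmetric])
  qed
  have "connected (u ` \<Omega>)"
  proof (rule connected_continuous_image)
    show "continuous_on \<Omega> u"
      using assms(11) closure_subset unfolding C2_closure_def by (blast intro: continuous_on_subset)
    show "connected \<Omega>" using assms(1) unfolding smooth_bounded_domain_def by blast
  qed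
  have not_less: "\<not> u x < u y" if "x \<in> \<Omega>" "y \<in> \<Omega>" for x y
  proof
    assume "u x < u y"
    moreover have "u x \<ge> - \<epsilon>" using nonneg(1)[OF that(1)] \<open>\<epsilon> > 0\<close> by simp
    ultimately obtain s where s: "u x < s" "s < u y" "P s \<noteq> s"
      using bounded_analytic_fixed_points_discrete[of \<epsilon> P c\<^sub>u "u x" "u y"] P_ext P_bound
      by blast
    have "s \<in> u ` \<Omega>"
      using connectedD_interval[OF \<open>connected (u ` \<Omega>)\<close>] that s by (meson imageI less_imp_le)
    then show False using fixed s(3) by auto
  qed
  have u_eq: "u x = u x\<^sub>0" if "x \<in> \<Omega>" for x
    using not_less[OF that x\<^sub>0] not_less[OF x\<^sub>0 that] by simp
  have v_eq: "v x = v x\<^sub>0" if "x \<in> \<Omega>" for x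
    unfolding v[OF that] v[OF x\<^sub>0] u_eq[OF that] ..
  have w_eq: "w x = w x\<^sub>0" and z_eq: "z x = z x\<^sub>0" if "x \<in> \<Omega>" for x
    using assms(18,19)[OF that] assms(18,19)[OF x\<^sub>0] u_eq[OF that] v_eq[OF that] by simp_all
  have "h constant_on closure \<Omega>" if "C2_closure \<Omega> h" "\<And>x. x \<in> \<Omega> \<Longrightarrow> h x = h x\<^sub>0" for h
    using that continuous_constant_on_closure[of \<Omega> h "h x\<^sub>0"]
    unfolding C2_closure_def constant_on_def by blast
  then show ?thesis using assms(11-14) u_eq v_eq w_eq z_eq by blast
qed (simp add: constant_on_def)

end
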